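(* Let $m\ge r\ge 1$ be integers, let $P$ be an $m\times m$ Hermitian positive definite complex matrix, and let $B\in\mathbb{C}^{m\times m}$ with $|B|\ne 0$. Let $Z$ be an $m\times r$ complex random matrix with a density $f_Z$ that is invariant under right unitary transformations, i.e. $f_Z(ZQ)=f_Z(Z)$ for every $Q\in\mathbb{C}^{r\times r}$ with $\bar Q'Q=I_r$. If the orientation $H_Z$ of $Z$ has the $CMACG(P)$ distribution, then the orientation $H_Y$ of $Y=BZ$ has the $CMACG(BP\bar B')$ distribution.
   Context: $\bar X'$ denotes the conjugate transpose of a complex matrix $X$ and $|\cdot|$ the determinant. Densities of random matrices in $\mathbb{C}^{m\times r}$ are with respect to Lebesgue measure on $\mathbb{C}^{m\times r}\cong\mathbb{R}^{2mr}$. The complex Stiefel manifold is $V_{r,m}^{\mathbb{C}}=\{X\in\mathbb{C}^{m\times r}:\bar X'X=I_r\}$. The normalized invariant measure on $V_{r,m}^{\mathbb{C}}$ is the unique Borel probability measure invariant under $X\mapsto UXQ$ for all unitary $U\in\mathbb{C}^{m\times m}$, $Q\in\mathbb{C}^{r\times r}$. For a matrix $X\in\mathbb{C}^{m\times r}$ of full column rank (which holds almost surely for a random matrix with a density), its orientation is $H_X=X(\bar X'X)^{-1/2}\in V_{r,m}^{\mathbb{C}}$, where $(\bar X'X)^{-1/2}$ is the inverse of the Hermitian positive definite square root of $\bar X'X$. For an $m\times m$ Hermitian positive definite matrix $P$, a random element of $V_{r,m}^{\mathbb{C}}$ has the $CMACG(P)$ distribution if it has density $H\mapsto|P|^{-r}|\bar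 H'P^{-1}H|^{-m}$ with respect to the normalized invariant measure on $V_{r,m}^{\mathbb{C}}$. *)

theory Defs
  imports "HOL-Probability.Probability"
begin

definition ctranspose :: "complex^'n^'m \<Rightarrow> complex^'m^'n" where
  "ctranspose A = (\<chi> i j. cnj (A $ j $ i))"

text \<open>The quadratic form of a Hermitian matrix is real, so \<open>Re\<close> below loses no information.\<close>

definition herm_pos_def :: "complex^'n^'n \<Rightarrow> bool" where
  "herm_pos_def A \<longleftrightarrow>
     ctranspose A = A \<and> (\<forall>x. x \<noteq> 0 \<longrightarrow> 0 < Re (\<Sum>i\<in>UNIV. cnj (x $ i) * (A *v x) $ i))"

definition unitary_matrix :: "complex^'n^'n \<Rightarrow> bool" where
  "unitary_matrix U \<longleftrightarrow> ctranspose U ** U = mat 1 \<and> U ** ctranspose U = mat 1"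

text \<open>The unique Hermitian positive definite square root; meaningful only if \<open>A\<close> is itself
  Hermitian positive definite.\<close>

definition herm_sqrt :: "complex^'n^'n \<Rightarrow> complex^'n^'n" where
  "herm_sqrt A = (THE S. herm_pos_def S \<and> S ** S = A)"

definition stiefel :: "(complex^'r^'m) set" where
  "stiefel = {X. ctranspose X ** X = mat 1}"

text \<open>The normalized invariant measure, as a measure whose underlying space is the
  Stiefel manifold with its (subspace) Borel sigma-algebra.\<close>

definition is_stiefel_measure :: "(complex^'r^'m) measure \<Rightarrow> bool" where
  "is_stiefel_measure \<mu> \<longleftrightarrow>
     sets \<mu> = sets (restrict_space borel stiefel) \<and> prob_space \<mu> \<and>
     (\<forall>U Q. unitary_matrix U \<longrightarrow> unitary_matrix Q \<longrightarrow> distr \<mu> \<mu> (\<lambda>X. U ** X ** Q) = \<mu>)"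

definition stiefel_measure :: "(complex^'r^'m) measure" where
  "stiefel_measure = (THE \<mu>. is_stiefel_measure \<mu>)"

text \<open>The orientation is a property of matrices of full column rank. The remaining matrices form a
  Lebesgue null set; they are sent to some fixed point of the Stiefel manifold, so that the
  orientation of a random matrix is a random element of the Stiefel manifold everywhere and
  not only almost surely. The choice of that point does not affect the distribution of the
  orientation of a random matrix that has a density.\<close>

definition orientation :: "complex^'r^'m \<Rightarrow> complex^'r^'m" where
  "orientation X =
     (if rank X = CARD('r) then X ** matrix_inv (herm_sqrt (ctranspose X ** X))
      else (SOME H. H \<in> stiefel))"

text \<open>For \<open>P\<close> Hermitian positive definite and \<open>H\<close> in the Stiefel manifold both determinants are
  positive real numbers; \<open>Re\<close> only converts their product to type \<^typ>\<open>real\<close>.\<close>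

definition CMACG_density :: "complex^'m^'m \<Rightarrow> complex^'r^'m \<Rightarrow> real" where
  "CMACG_density P H =
     Re (det P powi (- int CARD('r)) *
         det (ctranspose H ** matrix_inv P ** H) powi (- int CARD('m)))"

text \<open>\<open>CMACG M P H\<close>: the random element \<open>H\<close> on the probability space \<open>M\<close> has the
  \<open>CMACG(P)\<close> distribution.\<close>

definition CMACG :: "'a measure \<Rightarrow> complex^'m^'m \<Rightarrow> ('a \<Rightarrow> complex^'r^'m) \<Rightarrow> bool" where
  "CMACG M P H \<longleftrightarrow> herm_pos_def P \<and>
     distributed M stiefel_measure H (\<lambda>X. ennreal (CMACG_density P X))"

end

theory Submission
  imports Defs
begin

text \<open>
  The orientation of \<open>B ** X\<close> is not a function of the orientation \<open>H\<close> of \<open>X\<close>. If \<open>X = H ** S\<close> with \<open>S\<close>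
  positive definite, then \<open>B ** X\<close> and \<open>B ** H\<close> have the same column space, so their orientations
  differ by a unitary factor on the right, but this factor depends on \<open>S\<close>. A mean over the unitary
  group removes it. If \<open>Z\<close> has a density that is invariant under right unitary transformations, the
  expectation of \<open>F (orientation (B ** Z))\<close> equals that of \<open>G (orientation Z)\<close>, where \<open>G H\<close> is
  the mean of \<open>F (orientation (B ** H) ** Q)\<close> over a Haar distributed unitary \<open>Q\<close>
  (\<open>nn_integral_orientation_left_mult\<close>). The function \<open>G\<close> does not depend on the density. Hence the
  law of the orientation of \<open>B ** Z\<close> is determined by \<open>B\<close> and the law of the orientation of \<open>Z\<close>,
  and it suffices to find it for one random matrix whose orientation is \<open>CMACG(P)\<close> distributed.

  A convenient one is uniformly distributed on the ellipsoid \<open>norm (L ** X) \<le> 1\<close>, where the inverse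
  of \<open>P\<close> is \<open>ctranspose L ** L\<close>. Its density is right invariant, and multiplication by \<open>B\<close> carries
  it to the ellipsoid that belongs to \<open>B ** P ** ctranspose B\<close>. Its orientation is \<open>CMACG(P)\<close>
  distributed (\<open>nn_integral_ellipsoid_orientation\<close>). Indeed, for a fixed \<open>H\<close> and a random
  \<open>X = G ** S\<close>, the norm of \<open>L ** H ** S\<close> is the norm of \<open>X ** ctranspose R\<close>, where
  \<open>ctranspose R ** R\<close> is \<open>W = ctranspose H ** matrix_inv P ** H\<close>. So the integral over \<open>S\<close> in polar
  coordinates (\<open>nn_integral_polar\<close>) is the volume of the unit ball times the factor
  \<open>1 / cmod (det R) ^ (2 * m)\<close>, which is the power \<open>-m\<close> of \<open>det W\<close>. The remaining factor
  \<open>cmod (det L) ^ (2 * r)\<close> of the density is the reciprocal of the volume ratio of ellipsoid and ball.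

  The argument needs three groups of facts. Orientations are well defined by the existence and uniqueness
  of polar decompositions (\<open>polar_decomposition\<close>, \<open>herm_psd_square_inj\<close>). Lebesgue measure is
  scaled by \<open>cmod (det B) ^ (2 * r)\<close> under \<open>X \<mapsto> B ** X\<close> and by \<open>cmod (det R) ^ (2 * m)\<close> under
  \<open>X \<mapsto> X ** R\<close> (\<open>nn_integral_matrix_mult_left\<close>, \<open>nn_integral_matrix_mult_right\<close>), and almost all
  matrices have full rank (\<open>AE_full_rank\<close>). The invariant probability measure exists, as the law of
  the orientation of a uniform point of the unit ball, and is unique, because it is the law of
  \<open>V ** H\<close> for each fixed \<open>H\<close> in the Stiefel manifold and a Haar distributed unitary \<open>V\<close>
  (\<open>nn_integral_orbit_eq\<close>).
\<close>

section \<open>Conjugate transposes and the Frobenius inner product\<close>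

lemma ctranspose_ctranspose [simp]: "ctranspose (ctranspose A) = A"
  by (simp add: ctranspose_def vec_eq_iff)

lemma ctranspose_mult: "ctranspose (A ** B) = ctranspose B ** ctranspose A"
  by (simp add: ctranspose_def matrix_matrix_mult_def vec_eq_iff mult.commute)

lemma ctranspose_mat_1 [simp]: "ctranspose (mat 1) = mat 1"
  by (simp add: ctranspose_def mat_def vec_eq_iff)

lemma ctranspose_diff: "ctranspose (A - B) = ctranspose A - ctranspose B"
  by (simp add: ctranspose_def vec_eq_iff)

lemma det_ctranspose: "det (ctranspose A) = cnj (det A)"
proof -
  have "det (ctranspose A) = det (transpose (ctranspose A))"
    by simp
  also have "\<dots> = cnj (det A)"
    unfolding det_def by (simp add: ctranspose_def transpose_def)
  finally show ?thesis .
qed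

lemma continuous_on_matrix_mult [continuous_intros]:
  fixes f :: "'a::topological_space \<Rightarrow> complex^'n^'m" and g :: "'a \<Rightarrow> complex^'p^'n"
  assumes "continuous_on S f" "continuous_on S g"
  shows "continuous_on S (\<lambda>x. f x ** g x)"
  unfolding matrix_matrix_mult_def by (intro continuous_intros assms)

lemma continuous_on_ctranspose [continuous_intros]:
  fixes f :: "'a::topological_space \<Rightarrow> complex^'n^'m"
  assumes "continuous_on S f"
  shows "continuous_on S (\<lambda>x. ctranspose (f x))"
  unfolding ctranspose_def by (intro continuous_intros assms)

lemma continuous_on_det [continuous_intros]:
  fixes f :: "'a::topological_space \<Rightarrow> complex^'n^'n"
  assumes "continuous_on S f"
  shows "continuous_on S (\<lambda>x. det (f x))"
  unfolding det_def by (intro continuous_intros assms)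

lemma inner_complex_mult_left: "(a * b) \<bullet> c = b \<bullet> (cnj a * (c::complex))"
  by (simp add: inner_complex_def algebra_simps)

text \<open>
  The inner product that the type of complex matrices carries is the real part of the trace of
  \<open>ctranspose X ** Y\<close>, so multiplication by a matrix has multiplication by its conjugate transpose
  as its adjoint. Real inner products thus replace complex sesquilinear forms almost everywhere below.
\<close>

lemma inner_matrix_mult_left:
  fixes A :: "complex^'n^'m"
  shows "(A ** X) \<bullet> Y = X \<bullet> (ctranspose A ** Y)"
proof -
  have "(A ** X) \<bullet> Y = (\<Sum>i\<in>UNIV. \<Sum>j\<in>UNIV. \<Sum>k\<in>UNIV. X $ k $ j \<bullet> (cnj (A $ i $ k) * Y $ i $ j))"
    by (simp add: inner_vec_def matrix_matrix_mult_def inner_sum_left inner_complex_mult_left)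
  also have "\<dots> = (\<Sum>i\<in>UNIV. \<Sum>k\<in>UNIV. \<Sum>j\<in>UNIV. X $ k $ j \<bullet> (cnj (A $ i $ k) * Y $ i $ j))"
    by (intro sum.cong refl sum.swap)
  also have "\<dots> = (\<Sum>k\<in>UNIV. \<Sum>i\<in>UNIV. \<Sum>j\<in>UNIV. X $ k $ j \<bullet> (cnj (A $ i $ k) * Y $ i $ j))"
    by (rule sum.swap)
  also have "\<dots> = (\<Sum>k\<in>UNIV. \<Sum>j\<in>UNIV. \<Sum>i\<in>UNIV. X $ k $ j \<bullet> (cnj (A $ i $ k) * Y $ i $ j))"
    by (intro sum.cong refl sum.swap)
  also have "\<dots> = X \<bullet> (ctranspose A ** Y)"
    by (simp add: inner_vec_def matrix_matrix_mult_def inner_sum_right ctranspose_def)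
  finally show ?thesis .
qed

lemma inner_ctranspose: "ctranspose X \<bullet> ctranspose Y = X \<bullet> Y"
proof -
  have "ctranspose X \<bullet> ctranspose Y = (\<Sum>i\<in>UNIV. \<Sum>j\<in>UNIV. X $ j $ i \<bullet> Y $ j $ i)"
    by (simp add: inner_vec_def ctranspose_def inner_complex_def)
  also have "\<dots> = X \<bullet> Y"
    by (subst sum.swap) (simp add: inner_vec_def)
  finally show ?thesis .
qed

lemma norm_ctranspose: "norm (ctranspose X) = norm X"
  by (simp add: norm_eq_sqrt_inner inner_ctranspose)

lemma inner_matrix_mult_right:
  fixes A :: "complex^'n^'m"
  shows "(X ** A) \<bullet> Y = X \<bullet> (Y ** ctranspose A)"
proof -
  have "(X ** A) \<bullet> Y = (ctranspose A ** ctranspose X) \<bullet> ctranspose Y"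
    by (metis ctranspose_mult inner_ctranspose)
  also have "\<dots> = ctranspose X \<bullet> (A ** ctranspose Y)"
    by (simp add: inner_matrix_mult_left)
  also have "\<dots> = X \<bullet> (Y ** ctranspose A)"
    by (metis ctranspose_ctranspose ctranspose_mult inner_ctranspose)
  finally show ?thesis .
qed

lemma inner_matrix_vector_mult:
  fixes A :: "complex^'n^'m"
  shows "(A *v x) \<bullet> y = x \<bullet> (ctranspose A *v y)"
proof -
  have "(A *v x) \<bullet> y = (\<Sum>i\<in>UNIV. \<Sum>k\<in>UNIV. x $ k \<bullet> (cnj (A $ i $ k) * y $ i))"
    by (simp add: inner_vec_def matrix_vector_mult_def inner_sum_left inner_complex_mult_left)
  also have "\<dots> = (\<Sum>k\<in>UNIV. \<Sum>i\<in>UNIV. x $ k \<bullet> (cnj (A $ i $ k) * y $ i))"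
    by (rule sum.swap)
  also have "\<dots> = x \<bullet> (ctranspose A *v y)"
    by (simp add: inner_vec_def matrix_vector_mult_def inner_sum_right ctranspose_def)
  finally show ?thesis .
qed

lemma inner_column_sum:
  fixes X :: "complex^'n^'m"
  shows "X \<bullet> Y = (\<Sum>j\<in>UNIV. column j X \<bullet> column j Y)"
  unfolding inner_vec_def column_def by (subst sum.swap) simp

lemma column_matrix_mult: "column j (A ** X) = A *v column j X"
  by (simp add: column_def matrix_matrix_mult_def matrix_vector_mult_def)

lemma matrix_mult_diff_left: "(A - B) ** C = A ** C - B ** (C :: 'a::ring_1^'p^'n)"
  by (simp add: matrix_matrix_mult_def vec_eq_iff left_diff_distrib sum_subtractf)

lemma matrix_mult_diff_right: "A ** (B - C) = A ** B - A ** (C :: 'a::ring_1^'p^'n)"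
  by (simp add: matrix_matrix_mult_def vec_eq_iff right_diff_distrib sum_subtractf)

section \<open>Positive semidefinite matrices\<close>

definition herm_psd :: "complex^'n^'n \<Rightarrow> bool" where
  "herm_psd A \<longleftrightarrow> ctranspose A = A \<and> (\<forall>x. 0 \<le> x \<bullet> (A *v x))"

lemma herm_pos_def_inner:
  "herm_pos_def A \<longleftrightarrow> ctranspose A = A \<and> (\<forall>x. x \<noteq> 0 \<longrightarrow> 0 < x \<bullet> (A *v x))"
  by (simp add: herm_pos_def_def inner_vec_def inner_complex_def)

lemma herm_psd_if_pos_def: "herm_pos_def A \<Longrightarrow> herm_psd A"
  unfolding herm_pos_def_inner herm_psd_def
  by (metis inner_zero_left less_eq_real_def)

lemma invertible_if_pos_def:
  fixes A :: "complex^'n^'n"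
  assumes "herm_pos_def A"
  shows "invertible A"
  unfolding invertible_left_inverse matrix_left_invertible_ker
  using assms by (metis herm_pos_def_inner inner_zero_right less_irrefl)

lemma herm_psd_conjugate:
  assumes "herm_psd A"
  shows "herm_psd (ctranspose C ** A ** C)"
proof -
  have "x \<bullet> ((ctranspose C ** A ** C) *v x) = (C *v x) \<bullet> (A *v (C *v x))" for x
    by (simp add: inner_matrix_vector_mult matrix_vector_mul_assoc matrix_mul_assoc)
  then show ?thesis
    using assms by (simp add: herm_psd_def ctranspose_mult matrix_mul_assoc)
qed

text \<open>
  Otherwise the quadratic form at \<open>x + t *\<^sub>R (K *v x)\<close> would be negative for small negative \<open>t\<close>,
  as its derivative at \<open>t = 0\<close> is twice the squared norm of \<open>K *v x\<close>.
\<close>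

lemma herm_psd_kernel:
  assumes K: "herm_psd K" and x: "x \<bullet> (K *v x) = 0"
  shows "K *v x = 0"
proof (rule ccontr)
  define z where "z = K *v x"
  assume "K *v x \<noteq> 0"
  then have nz: "0 < z \<bullet> z"
    by (simp add: z_def)
  define c where "c = z \<bullet> (K *v z)"
  have quad: "0 \<le> 2 * t * (z \<bullet> z) + t\<^sup>2 * c" for t :: real
  proof -
    have xz: "x \<bullet> (K *v z) = z \<bullet> z"
      using K by (metis herm_psd_def inner_matrix_vector_mult z_def)
    have "0 \<le> (x + t *\<^sub>R z) \<bullet> (K *v (x + t *\<^sub>R z))"
      using K by (simp add: herm_psd_def)
    also have "K *v (x + t *\<^sub>R z) = z + t *\<^sub>R (K *v z)"
      by (simp add: z_def vec.linear_add matrix_vector_right_distrib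
          linear_scale[OF matrix_vector_mul_linear])
    also have "(x + t *\<^sub>R z) \<bullet> (z + t *\<^sub>R (K *v z)) = 2 * t * (z \<bullet> z) + t\<^sup>2 * c"
      using x xz
      by (simp add: inner_add_left inner_add_right c_def z_def power2_eq_square algebra_simps)
    finally show ?thesis .
  qed
  have c0: "0 \<le> c"
    using K by (simp add: c_def herm_psd_def)
  \<comment> \<open>near the minimiser \<open>- (z \<bullet> z) / c\<close> of the quadratic polynomial, but defined for \<open>c = 0\<close> too\<close>
  define t where "t = - (z \<bullet> z) / (c + 1)"
  have "2 * t * (z \<bullet> z) + t\<^sup>2 * c = (z \<bullet> z)\<^sup>2 * (c / (c+1)\<^sup>2 - 2 / (c + 1))"
    by (simp add: t_def power2_eq_square field_simps)
  then have quad': "0 \<le> (z \<bullet> z)\<^sup>2 * (c / (c+1)\<^sup>2 - 2 / (c + 1))"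
    using quad[of t] by simp
  have "c / (c+1)\<^sup>2 \<le> (c + 1) / (c+1)\<^sup>2"
    using c0 by (intro divide_right_mono) auto
  also have "\<dots> = 1 / (c + 1)"
    using c0 by (simp add: power2_eq_square)
  also have "\<dots> < 2 / (c + 1)"
    using c0 by (intro divide_strict_right_mono) auto
  finally have "(z \<bullet> z)\<^sup>2 * (c / (c+1)\<^sup>2 - 2 / (c + 1)) < 0"
    using nz by (simp add: mult_less_0_iff)
  then show False
    using quad' by simp
qed

text \<open>
  The inner product is the sum of the quadratic form of \<open>K\<close> over the columns of \<open>X\<close>.
\<close>

lemma herm_psd_inner_mult:
  assumes "herm_psd K"
  shows "0 \<le> X \<bullet> (K ** X)" and "X \<bullet> (K ** X) = 0 \<Longrightarrow> K ** X = 0"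
proof -
  have nn: "0 \<le> column j X \<bullet> (K *v column j X)" for j
    using assms by (simp add: herm_psd_def)
  have eq: "X \<bullet> (K ** X) = (\<Sum>j\<in>UNIV. column j X \<bullet> (K *v column j X))"
    by (simp add: inner_column_sum column_matrix_mult)
  show "0 \<le> X \<bullet> (K ** X)"
    unfolding eq by (intro sum_nonneg nn)
  assume "X \<bullet> (K ** X) = 0"
  then have "column j X \<bullet> (K *v column j X) = 0" for j
    unfolding eq using sum_nonneg_eq_0_iff[of UNIV "\<lambda>j. column j X \<bullet> (K *v column j X)"] nn
    by simp
  then have "column j (K ** X) = 0" for j
    unfolding column_matrix_mult using herm_psd_kernel[OF assms] by blast
  then show "K ** X = 0"
    by (simp add: column_def vec_eq_iff)
qed

text \<open>
  With \<open>D = K - L\<close> the hypothesis is the Sylvester equation \<open>K ** D + D ** L = 0\<close>. Its inner product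
  with \<open>D\<close> is a sum of two nonnegative terms, so \<open>K ** D\<close> and \<open>L ** D\<close> vanish, and hence so does
  \<open>D ** D\<close>.
\<close>

lemma herm_psd_square_inj:
  assumes K: "herm_psd K" and L: "herm_psd L" and eq: "K ** K = L ** L"
  shows "K = L"
proof -
  define D where "D = K - L"
  have D: "ctranspose D = D"
    using K L by (simp add: D_def ctranspose_diff herm_psd_def)
  have "K ** D + D ** L = 0"
    by (simp add: D_def matrix_mult_diff_left matrix_mult_diff_right eq)
  then have "D \<bullet> (K ** D) + D \<bullet> (D ** L) = 0"
    by (metis inner_add_right inner_zero_right)
  moreover have "D \<bullet> (D ** L) = D \<bullet> (L ** D)"
    using inner_ctranspose[of D "D ** L"] D L by (simp add: ctranspose_mult herm_psd_def)
  ultimately have "D \<bullet> (K ** D) = 0" "D \<bullet> (L ** D) = 0"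
    using herm_psd_inner_mult(1)[OF K, of D] herm_psd_inner_mult(1)[OF L, of D] by linarith+
  then have "K ** D = 0" "L ** D = 0"
    using herm_psd_inner_mult(2) K L by blast+
  moreover have "D ** D = K ** D - L ** D"
    unfolding D_def by (rule matrix_mult_diff_left)
  ultimately have "D ** D = 0"
    by simp
  moreover have "D \<bullet> D = mat 1 \<bullet> (D ** D)"
    using inner_matrix_mult_left[of D "mat 1" D] D by simp
  ultimately have "D = 0"
    by simp
  then show ?thesis
    by (simp add: D_def)
qed

text \<open>
  The unitary matrix that multiplies \<open>v\<close> by the phase \<open>z\<close> and fixes its orthogonal complement. These
  are the only unitary matrices that the variational argument below has to test.
\<close>

lemma reflection_in_stiefel:
  fixes v :: "complex^'n"
  assumes "v \<noteq> 0" "cmod z = 1"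
  shows "(\<chi> i j. of_bool (i = j) + (z - 1) / of_real (v \<bullet> v) * v $ i * cnj (v $ j)) \<in> stiefel"
proof -
  define s where "s = v \<bullet> v"
  define a where "a = (z - 1) / of_real s"
  have s: "s > 0"
    using assms by (simp add: s_def)
  have sum: "(\<Sum>k\<in>UNIV. cnj (v $ k) * v $ k) = of_real s"
    by (simp add: s_def inner_vec_def inner_complex_def complex_eq_iff)
  have "(z - 1) + cnj (z - 1) + cnj (z - 1) * (z - 1) = z * cnj z - 1"
    by (simp add: algebra_simps)
  also have "\<dots> = 0"
    using assms by (simp add: complex_mult_cnj cmod_power2[symmetric])
  finally have "((z - 1) + cnj (z - 1) + cnj (z - 1) * (z - 1)) / of_real s = 0"
    by simp
  then have a: "a + cnj a + cnj a * a * of_real s = 0"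
    using s by (simp only: a_def complex_cnj_divide complex_cnj_complex_of_real) (simp add: field_simps)
  have "(\<Sum>k\<in>UNIV. cnj (of_bool (k = i) + a * v $ k * cnj (v $ i)) *
          (of_bool (k = j) + a * v $ k * cnj (v $ j))) = of_bool (i = j)" for i j
  proof -
    have "(\<Sum>k\<in>UNIV. cnj (of_bool (k = i) + a * v $ k * cnj (v $ i)) *
          (of_bool (k = j) + a * v $ k * cnj (v $ j))) =
        (\<Sum>k\<in>UNIV. (if k = i then of_bool (k = j) + a * v $ k * cnj (v $ j) else 0) +
           (if k = j then cnj a * cnj (v $ k) * v $ i else 0) +
           (cnj (v $ k) * v $ k) * (cnj a * a * v $ i * cnj (v $ j)))"
      by (intro sum.cong refl) (auto simp: algebra_simps)
    also have "\<dots> = (of_bool (i = j) + a * v $ i * cnj (v $ j)) + cnj a * cnj (v $ j) * v $ i +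
        of_real s * (cnj a * a * v $ i * cnj (v $ j))"
      by (simp only: sum.distrib sum_distrib_right[symmetric] sum) simp
    also have "\<dots> = of_bool (i = j) + (a + cnj a + cnj a * a * of_real s) * (v $ i * cnj (v $ j))"
      by (simp add: algebra_simps)
    finally show ?thesis
      by (simp add: a)
  qed
  then show ?thesis
    unfolding stiefel_def a_def[symmetric] s_def[symmetric]
    by (simp add: ctranspose_def matrix_matrix_mult_def mat_def vec_eq_iff of_bool_def)
qed

text \<open>
  Comparing the identity with the matrix that multiplies a vector \<open>v\<close> by a phase \<open>z\<close> shows that the
  value \<open>q\<close> of the form of \<open>K\<close> at \<open>v\<close> satisfies \<open>Re (cnj z * q) \<le> Re q\<close>. For \<open>z = q / cmod q\<close> this
  says that \<open>q\<close> is a nonnegative real number.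
\<close>

lemma herm_psd_if_unitary_max:
  fixes K :: "complex^'n^'n"
  assumes max: "\<And>U. U \<in> stiefel \<Longrightarrow> U \<bullet> K \<le> mat 1 \<bullet> K"
  shows "herm_psd K"
proof -
  define q where "q v = (\<Sum>i\<in>UNIV. cnj (v $ i) * (K *v v) $ i)" for v
  have q: "Im (q v) = 0 \<and> 0 \<le> Re (q v)" for v
  proof (cases "v = 0 \<or> q v = 0")
    case True
    then have "q v = 0"
      by (auto simp: q_def)
    then show ?thesis
      by simp
  next
    case False
    define z where "z = q v / of_real (cmod (q v))"
    have z: "cmod z = 1" "cnj z * q v = of_real (cmod (q v))"
      using False complex_norm_square[of "q v"]
      by (simp_all add: z_def norm_divide field_simps power2_eq_square)
    define a where "a = (z - 1) / of_real (v \<bullet> v)"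
    have "(\<chi> i j. of_bool (i = j) + a * v $ i * cnj (v $ j)) \<bullet> K
        = (\<Sum>i\<in>UNIV. \<Sum>j\<in>UNIV. of_bool (i = j) \<bullet> K $ i $ j)
          + (\<Sum>i\<in>UNIV. \<Sum>j\<in>UNIV. Re (cnj a * (cnj (v $ i) * (K $ i $ j * v $ j))))"
    proof -
      have "(a * v $ i * cnj (v $ j)) \<bullet> K $ i $ j = Re (cnj a * (cnj (v $ i) * (K $ i $ j * v $ j)))" for i j
        by (simp add: inner_complex_def algebra_simps)
      then show ?thesis
        by (simp only: inner_vec_def vec_lambda_beta inner_add_left sum.distrib)
    qed
    also have "(\<Sum>i\<in>UNIV. \<Sum>j\<in>UNIV. Re (cnj a * (cnj (v $ i) * (K $ i $ j * v $ j)))) = Re (cnj a * q v)"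
      by (simp add: q_def matrix_vector_mult_def sum_distrib_left del: times_complex.simps)
    also have "(\<Sum>i\<in>UNIV. \<Sum>j\<in>UNIV. of_bool (i = j) \<bullet> K $ i $ j) = mat 1 \<bullet> K"
      by (simp add: inner_vec_def mat_def of_bool_def)
    finally have "Re (cnj a * q v) \<le> 0"
      using max[OF reflection_in_stiefel, of v z] False z(1) by (simp add: a_def)
    moreover have "cnj a * q v = (cnj z * q v - q v) / of_real (v \<bullet> v)"
      by (simp add: a_def field_simps)
    moreover have "0 < v \<bullet> v"
      using False by simp
    ultimately have "cmod (q v) \<le> Re (q v)"
      unfolding z(2) by (simp add: divide_le_0_iff)
    then show ?thesis
      by (smt (verit) abs_Re_le_cmod cmod_eq_Re norm_ge_zero cmod_power2 power2_eq_iff_nonneg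
          zero_eq_power2)
  qed
  have "ctranspose K *v x = K *v x" for x
  proof -
    \<comment> \<open>polarisation of the vanishing imaginary part\<close>
    have im: "(\<i> *s v) \<bullet> (K *v v) = 0" for v
    proof -
      have "(\<i> *s v) \<bullet> (K *v v) = Im (q v)"
        by (simp add: q_def inner_vec_def inner_complex_def)
      then show ?thesis
        using q by simp
    qed
    have "(\<i> *s y) \<bullet> (K *v x - ctranspose K *v x) = 0" for y
    proof -
      have "(\<i> *s x) \<bullet> (K *v y) + (\<i> *s y) \<bullet> (K *v x) = 0"
        using im[of "x + y"] im[of x] im[of y]
        by (simp add: vec.scale_right_distrib matrix_vector_right_distrib inner_add_left inner_add_right)
      moreover have "(\<i> *s x) \<bullet> (K *v y) = - (x \<bullet> (\<i> *s (K *v y)))"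
        by (simp add: inner_vec_def inner_complex_def sum_negf[symmetric])
      moreover have "x \<bullet> (\<i> *s (K *v y)) = (ctranspose K *v x) \<bullet> (\<i> *s y)"
        by (simp add: inner_matrix_vector_mult vector_scalar_commute)
      ultimately show ?thesis
        by (simp add: inner_diff_right inner_commute)
    qed
    from this[of "- \<i> *s (K *v x - ctranspose K *v x)"] show ?thesis
      by simp
  qed
  then have "ctranspose K = K"
    by (simp add: matrix_eq)
  moreover have "x \<bullet> (K *v x) = Re (q x)" for x
    by (simp add: q_def inner_vec_def inner_complex_def)
  ultimately show ?thesis
    using q by (simp add: herm_psd_def)
qed

section \<open>The Stiefel manifold and the polar decomposition\<close>

lemma unitary_iff_stiefel: "unitary_matrix U \<longleftrightarrow> U \<in> stiefel"
  by (auto simp: unitary_matrix_def stiefel_def matrix_left_right_inverse)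

lemma stiefel_mult: "H \<in> stiefel \<Longrightarrow> G \<in> stiefel \<Longrightarrow> H ** G \<in> stiefel"
  unfolding stiefel_def by (simp add: ctranspose_mult) (metis matrix_mul_assoc matrix_mul_lid)

lemma ctranspose_in_stiefel:
  fixes U :: "complex^'n^'n"
  shows "U \<in> stiefel \<Longrightarrow> ctranspose U \<in> stiefel"
  by (simp add: stiefel_def matrix_left_right_inverse)

lemma compact_stiefel: "compact (stiefel :: (complex^'r^'m) set)"
proof (rule compact_eq_bounded_closed[THEN iffD2], intro conjI)
  have "norm X = sqrt (mat 1 \<bullet> (mat 1 :: complex^'r^'r))" if "X \<in> stiefel" for X :: "complex^'r^'m"
    using inner_matrix_mult_left[of X "mat 1" X] that
    by (simp add: stiefel_def norm_eq_sqrt_inner)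
  then show "bounded (stiefel :: (complex^'r^'m) set)"
    unfolding bounded_iff by (metis order_refl)
  have "closed ((\<lambda>X::complex^'r^'m. ctranspose X ** X) -` {mat 1})"
    by (intro closed_vimage closed_singleton continuous_intros)
  moreover have "stiefel = (\<lambda>X::complex^'r^'m. ctranspose X ** X) -` {mat 1}"
    by (auto simp: stiefel_def)
  ultimately show "closed (stiefel :: (complex^'r^'m) set)"
    by simp
qed

lemma stiefel_nonempty:
  assumes "CARD('r) \<le> CARD('m)"
  shows "(stiefel :: (complex^'r^'m) set) \<noteq> {}"
proof -
  obtain g :: "'r \<Rightarrow> 'm" where g: "inj g"
    using assms card_le_inj[of "UNIV::'r set" "UNIV::'m set"] by auto
  have "cnj (of_bool (k = g i)) * of_bool (k = g j) = (if k = g i then of_bool (i = j) else (0::complex))"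
    for i j k using g by (auto simp: inj_def)
  then have "(\<chi> i j. of_bool (i = g j) :: complex^'r^'m) \<in> stiefel"
    by (simp add: stiefel_def ctranspose_def matrix_matrix_mult_def mat_def vec_eq_iff of_bool_def)
  then show ?thesis
    by blast
qed

text \<open>
  A point \<open>H\<close> of the compact Stiefel manifold that maximises the inner product with \<open>X\<close> is the
  unitary factor. Varying \<open>H\<close> by unitary matrices on the right and on the left shows that
  \<open>ctranspose H ** X\<close> and \<open>X ** ctranspose H\<close> are positive semidefinite, and the two symmetries give
  \<open>X = X ** ctranspose H ** H = H ** ctranspose X ** H = H ** ctranspose H ** X\<close>.
\<close>

lemma polar_decomposition:
  fixes X :: "complex^'r^'m"
  assumes "CARD('r) \<le> CARD('m)"
  obtains H where "H \<in> stiefel" "herm_psd (ctranspose H ** X)" "X = H ** (ctranspose H ** X)"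
proof -
  have "continuous_on stiefel (\<lambda>H. H \<bullet> X)"
    by (intro continuous_intros)
  then obtain H :: "complex^'r^'m" where H: "H \<in> stiefel"
    and max: "\<And>G. G \<in> stiefel \<Longrightarrow> G \<bullet> X \<le> H \<bullet> X"
    using continuous_attains_sup[OF compact_stiefel stiefel_nonempty[OF assms]] by metis
  have "U \<bullet> (ctranspose H ** X) \<le> mat 1 \<bullet> (ctranspose H ** X)" if "U \<in> stiefel" for U
    using max[OF stiefel_mult[OF H that]] inner_matrix_mult_left[of H "mat 1" X]
    by (simp add: inner_matrix_mult_left)
  then have psd: "herm_psd (ctranspose H ** X)"
    by (rule herm_psd_if_unitary_max)
  have "U \<bullet> (X ** ctranspose H) \<le> mat 1 \<bullet> (X ** ctranspose H)" if "U \<in> stiefel" for U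
    using max[OF stiefel_mult[OF that H]] inner_matrix_mult_right[of "mat 1" H X]
    by (simp add: inner_matrix_mult_right)
  then have "herm_psd (X ** ctranspose H)"
    by (rule herm_psd_if_unitary_max)
  then have "X ** ctranspose H ** H = H ** ctranspose X ** H"
    by (metis ctranspose_ctranspose ctranspose_mult herm_psd_def)
  moreover have "ctranspose X ** H = ctranspose H ** X"
    using psd by (metis ctranspose_ctranspose ctranspose_mult herm_psd_def)
  moreover have "X ** ctranspose H ** H = X"
    using H by (simp add: stiefel_def matrix_mul_assoc[symmetric])
  ultimately have "X = H ** (ctranspose H ** X)"
    by (simp add: matrix_mul_assoc[symmetric])
  then show thesis
    using that H psd by blast
qed

text \<open>
  The unitary factor \<open>U\<close> of \<open>Y ** ctranspose X\<close> does it: the positive factor has the same square as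
  the projection \<open>X ** ctranspose X\<close>, hence equals it.
\<close>

lemma unitary_transitive_on_stiefel:
  fixes X Y :: "complex^'r^'m"
  assumes X: "X \<in> stiefel" and Y: "Y \<in> stiefel"
  obtains U where "U \<in> stiefel" "U ** X = Y"
proof -
  obtain U where U: "U \<in> stiefel" and psd: "herm_psd (ctranspose U ** (Y ** ctranspose X))"
    and eq: "Y ** ctranspose X = U ** (ctranspose U ** (Y ** ctranspose X))"
    using polar_decomposition[of "Y ** ctranspose X"] by auto
  define K where "K = ctranspose U ** (Y ** ctranspose X)"
  define E where "E = X ** ctranspose X"
  have XX: "ctranspose X ** X = mat 1" and YY: "ctranspose Y ** Y = mat 1"
    using X Y by (simp_all add: stiefel_def)
  have UU: "U ** ctranspose U = mat 1"
    using U unitary_iff_stiefel unitary_matrix_def by blast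
  have "herm_psd (ctranspose (ctranspose X) ** mat 1 ** ctranspose X)"
    by (intro herm_psd_conjugate) (simp add: herm_psd_def)
  then have E: "herm_psd E"
    by (simp add: E_def)
  have "K ** K = ctranspose K ** K"
    using psd by (simp add: herm_psd_def K_def)
  also have "\<dots> = X ** (ctranspose Y ** ((U ** ctranspose U) ** (Y ** ctranspose X)))"
    by (simp add: K_def ctranspose_mult matrix_mul_assoc)
  also have "\<dots> = X ** ((ctranspose Y ** Y) ** ctranspose X)"
    by (simp add: UU matrix_mul_assoc)
  also have "\<dots> = X ** ((ctranspose X ** X) ** ctranspose X)"
    by (simp add: XX YY)
  also have "\<dots> = E ** E"
    by (simp add: E_def matrix_mul_assoc)
  finally have "K = E"
    using herm_psd_square_inj psd E K_def by blast
  then have "Y ** ctranspose X ** X = U ** X ** ctranspose X ** X"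
    using eq by (simp add: K_def E_def matrix_mul_assoc)
  then have "U ** X = Y"
    using XX by (simp add: matrix_mul_assoc[symmetric])
  then show thesis
    using that U by blast
qed

section \<open>Orientation\<close>

lemma matrix_inv_inverse:
  assumes "invertible A"
  shows "A ** matrix_inv A = mat 1" "matrix_inv A ** A = mat 1"
proof -
  have "A ** matrix_inv A = mat 1 \<and> matrix_inv A ** A = mat 1"
    unfolding matrix_inv_def by (rule someI_ex) (use assms in \<open>simp add: invertible_def\<close>)
  then show "A ** matrix_inv A = mat 1" "matrix_inv A ** A = mat 1"
    by auto
qed

text \<open>
  Full column rank, stated by the kernel because this form passes to products and to right factors
  without any dimension count.
\<close>

definition full_rank :: "complex^'r^'m \<Rightarrow> bool" where
  "full_rank X \<longleftrightarrow> (\<forall>v. X *v v = 0 \<longrightarrow> v = 0)"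

lemma full_rank_iff_rank: "full_rank X \<longleftrightarrow> rank X = CARD('r)"
  for X :: "complex^'r^'m"
proof -
  have "rank X = CARD('r) \<longleftrightarrow> vec.span (rows X) = UNIV"
    unfolding row_rank_def_gen vec.dim_eq_full[symmetric]
    by (simp add: card_cart_basis vec.dimension_def)
  then show ?thesis
    unfolding full_rank_def matrix_left_invertible_span_rows_gen[symmetric]
      matrix_left_invertible_ker by simp
qed

lemma full_rank_square_iff: "full_rank A \<longleftrightarrow> det A \<noteq> 0"
  for A :: "complex^'n^'n"
  unfolding full_rank_def invertible_det_nz[symmetric] invertible_left_inverse
    matrix_left_invertible_ker by simp

lemma full_rank_iff_gram: "full_rank X \<longleftrightarrow> det (ctranspose X ** X) \<noteq> 0"
proof -
  have "X *v v = 0 \<longleftrightarrow> (ctranspose X ** X) *v v = 0" for v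
  proof
    assume "(ctranspose X ** X) *v v = 0"
    then have "(X *v v) \<bullet> (X *v v) = 0"
      by (simp add: inner_matrix_vector_mult matrix_vector_mul_assoc)
    then show "X *v v = 0"
      by simp
  qed (simp add: matrix_vector_mul_assoc[symmetric])
  then show ?thesis
    unfolding full_rank_square_iff[symmetric] full_rank_def by simp
qed

lemma full_rank_stiefel: "H \<in> stiefel \<Longrightarrow> full_rank H"
  by (simp add: full_rank_iff_gram stiefel_def)

lemma full_rank_mult: "full_rank X \<Longrightarrow> full_rank Y \<Longrightarrow> full_rank (X ** Y)"
  by (simp add: full_rank_def matrix_vector_mul_assoc[symmetric])

lemma full_rank_mult_right: "full_rank (X ** Y) \<Longrightarrow> full_rank Y"
  by (auto simp: full_rank_def matrix_vector_mul_assoc[symmetric])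

lemma herm_pos_def_iff_full_rank: "herm_pos_def A \<longleftrightarrow> herm_psd A \<and> full_rank A"
proof
  assume "herm_pos_def A"
  then show "herm_psd A \<and> full_rank A"
    using herm_psd_if_pos_def invertible_if_pos_def
    by (auto simp: full_rank_square_iff invertible_det_nz)
next
  assume A: "herm_psd A \<and> full_rank A"
  then have "x \<bullet> (A *v x) \<noteq> 0" if "x \<noteq> 0" for x
    using herm_psd_kernel[of A x] that by (auto simp: full_rank_def)
  then show "herm_pos_def A"
    using A unfolding herm_pos_def_inner herm_psd_def by (metis order_le_less)
qed

lemma herm_pos_def_conjugate:
  assumes "herm_pos_def A" "full_rank C"
  shows "herm_pos_def (ctranspose C ** A ** C)"
proof -
  have "x \<bullet> ((ctranspose C ** A ** C) *v x) = (C *v x) \<bullet> (A *v (C *v x))" for x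
    by (simp add: inner_matrix_vector_mult matrix_vector_mul_assoc matrix_mul_assoc)
  then show ?thesis
    using assms by (simp add: herm_pos_def_inner ctranspose_mult matrix_mul_assoc full_rank_def) metis
qed

text \<open>
  Uniqueness of the polar decomposition. With \<open>orientation_polar\<close> it replaces the square root in the
  definition of the orientation of a matrix of full rank.
\<close>

lemma orientation_eqI:
  assumes X: "full_rank X" and H: "H \<in> stiefel" and K: "herm_psd K" and eq: "X = H ** K"
  shows "orientation X = H"
proof -
  have "full_rank K"
    using X eq full_rank_mult_right by blast
  then have K': "herm_pos_def K"
    using K herm_pos_def_iff_full_rank by blast
  have "ctranspose X ** X = K ** (ctranspose H ** H) ** K"
    using K by (simp add: eq ctranspose_mult herm_psd_def matrix_mul_assoc)
  then have KK: "K ** K = ctranspose X ** X"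
    using H by (simp add: stiefel_def)
  have "herm_sqrt (ctranspose X ** X) = K"
    unfolding herm_sqrt_def
  proof (rule the_equality)
    show "S = K" if "herm_pos_def S \<and> S ** S = ctranspose X ** X" for S
      using herm_psd_square_inj[OF herm_psd_if_pos_def K, of S] that KK by simp
  qed (simp add: K' KK)
  then have "orientation X = H ** (K ** matrix_inv K)"
    using X by (simp add: orientation_def full_rank_iff_rank eq matrix_mul_assoc)
  then show ?thesis
    using matrix_inv_inverse[OF invertible_if_pos_def[OF K']] by simp
qed

lemma orientation_polar:
  fixes X :: "complex^'r^'m"
  assumes "CARD('r) \<le> CARD('m)" "full_rank X"
  shows "herm_psd (ctranspose (orientation X) ** X)"
    and "X = orientation X ** (ctranspose (orientation X) ** X)"
    and "orientation X \<in> stiefel"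
proof -
  obtain H where H: "H \<in> stiefel" "herm_psd (ctranspose H ** X)" "X = H ** (ctranspose H ** X)"
    using polar_decomposition[OF assms(1)] by blast
  then have "orientation X = H"
    using orientation_eqI[OF assms(2)] by blast
  then show "herm_psd (ctranspose (orientation X) ** X)"
    "X = orientation X ** (ctranspose (orientation X) ** X)" "orientation X \<in> stiefel"
    using H by auto
qed

lemma orientation_in_stiefel:
  fixes X :: "complex^'r^'m"
  assumes "CARD('r) \<le> CARD('m)"
  shows "orientation X \<in> stiefel"
proof (cases "full_rank X")
  case False
  then show ?thesis
    using stiefel_nonempty[OF assms]
    by (simp add: orientation_def full_rank_iff_rank some_in_eq)
qed (rule orientation_polar(3)[OF assms])

text \<open>
  Multiplying the factors of \<open>X = H ** S\<close> by unitary matrices gives the polar decomposition with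
  positive factor \<open>ctranspose Q ** S ** Q\<close>.
\<close>

lemma orientation_unitary_mult:
  fixes X :: "complex^'r^'m" and U :: "complex^'m^'m" and Q :: "complex^'r^'r"
  assumes rm: "CARD('r) \<le> CARD('m)" and X: "full_rank X" and U: "U \<in> stiefel" and Q: "Q \<in> stiefel"
  shows "orientation (U ** X ** Q) = U ** orientation X ** Q"
proof (rule orientation_eqI)
  note polar = orientation_polar[OF rm X]
  show "full_rank (U ** X ** Q)"
    using X full_rank_stiefel[OF U] full_rank_stiefel[OF Q] by (intro full_rank_mult)
  show "U ** orientation X ** Q \<in> stiefel"
    using U Q polar(3) by (intro stiefel_mult)
  show "herm_psd (ctranspose Q ** (ctranspose (orientation X) ** X) ** Q)"
    by (intro herm_psd_conjugate polar(1))
  have "Q ** ctranspose Q = mat 1"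
    using Q unitary_iff_stiefel[of Q] by (simp add: unitary_matrix_def)
  then show "U ** X ** Q = U ** orientation X ** Q ** (ctranspose Q ** (ctranspose (orientation X) ** X) ** Q)"
    using polar(2) by (metis matrix_mul_assoc matrix_mul_rid)
qed

text \<open>
  With \<open>X = H ** S\<close> and \<open>B ** H = G ** T\<close>, the polar decomposition \<open>T ** S = Q ** K\<close> of a square
  matrix gives \<open>B ** X = (G ** Q) ** K\<close>.
\<close>

lemma orientation_left_mult:
  fixes X :: "complex^'r^'m" and B :: "complex^'m^'m"
  assumes rm: "CARD('r) \<le> CARD('m)" and X: "full_rank X" and B: "full_rank B"
  obtains Q where "Q \<in> stiefel" "orientation (B ** X) = orientation (B ** orientation X) ** Q"
proof -
  define H where "H = orientation X"
  define S where "S = ctranspose H ** X"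
  have XHS: "X = H ** S"
    using orientation_polar(2)[OF rm X] by (simp add: H_def S_def)
  define G where "G = orientation (B ** H)"
  define T where "T = ctranspose G ** (B ** H)"
  have BH: "full_rank (B ** H)"
    using B orientation_in_stiefel[OF rm] by (simp add: full_rank_mult full_rank_stiefel H_def)
  have BHGT: "B ** H = G ** T"
    using orientation_polar(2)[OF rm BH] by (simp add: G_def T_def)
  obtain Q where Q: "Q \<in> stiefel" "herm_psd (ctranspose Q ** (T ** S))"
    and QTS: "T ** S = Q ** (ctranspose Q ** (T ** S))"
    using polar_decomposition[of "T ** S"] by auto
  have "orientation (B ** X) = G ** Q"
  proof (rule orientation_eqI)
    show "full_rank (B ** X)"
      using X B by (rule full_rank_mult[rotated])
    show "G ** Q \<in> stiefel"
      unfolding G_def by (intro stiefel_mult orientation_in_stiefel[OF rm] Q)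
    show "herm_psd (ctranspose Q ** (T ** S))"
      by fact
    have "B ** X = G ** (T ** S)"
      by (metis BHGT XHS matrix_mul_assoc)
    then show "B ** X = G ** Q ** (ctranspose Q ** (T ** S))"
      using QTS by (metis matrix_mul_assoc)
  qed
  then show thesis
    using that[OF Q(1)] by (simp add: G_def H_def)
qed

lemma open_full_rank: "open {X :: complex^'r^'m. full_rank X}"
proof -
  have "{X :: complex^'r^'m. full_rank X} = - {X. det (ctranspose X ** X) = 0}"
    by (auto simp: full_rank_iff_gram)
  moreover have "closed {X :: complex^'r^'m. det (ctranspose X ** X) = 0}"
    by (intro closed_Collect_eq continuous_intros)
  ultimately show ?thesis
    by (simp add: open_Compl)
qed

text \<open>
  The graph is cut out by the closed conditions of the polar decomposition, and the values lie in a
  compact set.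
\<close>

lemma continuous_on_orientation:
  assumes rm: "CARD('r) \<le> CARD('m)"
  shows "continuous_on {X :: complex^'r^'m. full_rank X} orientation"
proof (subst continuous_closed_graph_eq[OF compact_stiefel])
  let ?S = "{X :: complex^'r^'m. full_rank X}"
  let ?C = "{p :: (complex^'r^'m) \<times> (complex^'r^'m).
      herm_psd (ctranspose (snd p) ** fst p) \<and> fst p = snd p ** (ctranspose (snd p) ** fst p)}"
  show "orientation \<in> ?S \<rightarrow> stiefel"
    using orientation_in_stiefel[OF rm] by blast
  have "closed ?C"
    unfolding herm_psd_def matrix_vector_mult_def
    by (intro closed_Collect_conj closed_Collect_all closed_Collect_eq closed_Collect_le continuous_intros)
  moreover have "(\<lambda>X. (X, orientation X)) ` ?S = ?S \<times> stiefel \<inter> ?C"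
    using orientation_polar[OF rm] orientation_eqI by (force simp: image_iff)
  ultimately show "closedin (top_of_set (?S \<times> stiefel)) ((\<lambda>X. (X, orientation X)) ` ?S)"
    unfolding closedin_closed by blast
qed

lemma borel_measurable_orientation:
  assumes rm: "CARD('r) \<le> CARD('m)"
  shows "(orientation :: complex^'r^'m \<Rightarrow> _) \<in> borel_measurable borel"
proof -
  have "(\<lambda>X :: complex^'r^'m. if X \<in> {X. full_rank X} then orientation X else (SOME H. H \<in> stiefel))
      \<in> borel_measurable borel"
    by (intro borel_measurable_continuous_on_if continuous_on_orientation[OF rm] continuous_intros
        borel_open[OF open_full_rank])
  moreover have "(\<lambda>X :: complex^'r^'m. if X \<in> {X. full_rank X} then orientation X else (SOME H. H \<in> stiefel))
      = orientation"
    by (rule ext) (simp add: orientation_def full_rank_iff_rank)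
  ultimately show ?thesis
    by simp
qed

section \<open>Factorisation of positive definite matrices\<close>

text \<open>
  If the columns of \<open>V\<close> are orthonormal for the inner product that \<open>W\<close> defines, then
  \<open>ctranspose V ** W ** V\<close> is the identity and the inverse of \<open>V\<close> is the required factor.
\<close>

lemma herm_pos_def_factor:
  fixes W :: "complex^'n^'n"
  assumes W: "herm_pos_def W"
  obtains R where "det R \<noteq> 0" "W = ctranspose R ** R"
proof -
  define form where "form x y = (\<Sum>i\<in>UNIV. cnj (x $ i) * (W *v y) $ i)" for x y
  have form_scale: "form (c *s x) y = cnj c * form x y" "form x (c *s y) = c * form x y" for c x y
    by (simp_all add: form_def sum_distrib_left vector_scalar_commute algebra_simps)
  have form_sym: "form y x = cnj (form x y)" for x y
  proof -
    have W': "cnj (W $ i $ j) = W $ j $ i" for i j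
      using W by (simp add: herm_pos_def_def ctranspose_def vec_eq_iff)
    have "form y x = (\<Sum>i\<in>UNIV. \<Sum>j\<in>UNIV. cnj (y $ i) * (W $ i $ j * x $ j))"
      by (simp add: form_def matrix_vector_mult_def sum_distrib_left)
    also have "\<dots> = (\<Sum>j\<in>UNIV. \<Sum>i\<in>UNIV. cnj (y $ i) * (W $ i $ j * x $ j))"
      by (rule sum.swap)
    also have "\<dots> = cnj (form x y)"
      by (simp add: form_def matrix_vector_mult_def sum_distrib_left W' algebra_simps)
    finally show ?thesis .
  qed
  have form_pos: "\<exists>t>0. form x x = of_real t" if "x \<noteq> 0" for x
  proof (intro exI conjI)
    show "0 < Re (form x x)"
      using W that by (simp add: herm_pos_def_def form_def)
    show "form x x = of_real (Re (form x x))"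
      using form_sym[of x x] by (simp add: complex_eq_iff)
  qed
  \<comment> \<open>Gram-Schmidt for the inner product defined by \<open>W\<close>\<close>
  have "\<exists>v. \<forall>i\<in>S. \<forall>j\<in>S. form (v i) (v j) = of_bool (i = j)" if "finite S" for S :: "'n set"
    using that
  proof induction
    case (insert k S)
    then obtain v where v: "\<And>i j. i \<in> S \<Longrightarrow> j \<in> S \<Longrightarrow> form (v i) (v j) = of_bool (i = j)"
      by blast
    \<comment> \<open>row \<open>k\<close> is zero, so \<open>A\<close> annihilates a nonzero vector, which is orthogonal to all \<open>v i\<close>\<close>
    define A :: "complex^'n^'n" where "A = (\<chi> i. if i \<in> S then (\<chi> l. cnj ((W *v v i) $ l)) else 0)"
    have "row k A = 0"
      using insert.hyps by (simp add: row_def A_def vec_eq_iff)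
    then have "\<not> full_rank A"
      by (simp add: full_rank_square_iff det_zero_row(1))
    then obtain u where u: "A *v u = 0" "u \<noteq> 0"
      by (auto simp: full_rank_def)
    have uv: "form u (v i) = 0" if "i \<in> S" for i
    proof -
      have "cnj (form u (v i)) = (A *v u) $ i"
        using that by (simp add: form_def A_def matrix_vector_mult_def algebra_simps)
      then show ?thesis
        using u by simp
    qed
    obtain t where t: "0 < t" "form u u = of_real t"
      using form_pos[OF u(2)] by blast
    define w where "w = of_real (1 / sqrt t) *s u"
    have "of_real (1 / sqrt t) * of_real (1 / sqrt t) * (of_real t :: complex) = 1"
      unfolding of_real_mult[symmetric] using t by simp
    then have "form w w = 1"
      by (simp add: w_def form_scale t(2) mult.assoc del: of_real_divide)
    moreover have "form w (v i) = 0" "form (v i) w = 0" if "i \<in> S" for i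
      using uv[OF that] form_sym[of "v i" w] by (simp_all add: w_def form_scale form_sym[of u "v i"])
    ultimately have "\<forall>i\<in>insert k S. \<forall>j\<in>insert k S. form ((v(k := w)) i) ((v(k := w)) j) = of_bool (i = j)"
      using v insert.hyps by auto
    then show ?case
      by blast
  qed simp
  from this[of UNIV] obtain v :: "'n \<Rightarrow> complex^'n"
    where v: "\<And>i j. form (v i) (v j) = of_bool (i = j)"
    by auto
  define V where "V = (\<chi> i j. v j $ i)"
  have V1: "ctranspose V ** (W ** V) = mat 1"
    using v by (simp add: V_def form_def matrix_matrix_mult_def matrix_vector_mult_def ctranspose_def
        mat_def vec_eq_iff of_bool_def)
  then have "det V \<noteq> 0"
    by (metis det_I det_mul mult_zero_right zero_neq_one)
  then obtain R where R: "V ** R = mat 1" "R ** V = mat 1"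
    by (meson invertible_def invertible_det_nz)
  have R': "ctranspose R ** ctranspose V = mat 1"
    using R(1) by (metis ctranspose_mat_1 ctranspose_mult)
  have "W = (ctranspose R ** ctranspose V) ** W ** (V ** R)"
    by (simp add: R R')
  also have "\<dots> = ctranspose R ** (ctranspose V ** (W ** V)) ** R"
    by (simp add: matrix_mul_assoc)
  finally have "W = ctranspose R ** R"
    by (simp add: V1)
  moreover have "det R \<noteq> 0"
    using R by (metis invertible_def invertible_det_nz)
  ultimately show thesis
    using that by blast
qed

section \<open>Multiplicative functions of invertible matrices\<close>

definition identity_with_column :: "'n \<Rightarrow> complex^'n \<Rightarrow> complex^'n^'n" where
  "identity_with_column k c = (\<chi> i j. if j = k then c $ i else of_bool (i = j))"

lemma identity_with_column_mult:
  "identity_with_column k c ** identity_with_column k d = identity_with_column k (d $ k *s c + d - d $ k *s axis k 1)"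
proof -
  have "(identity_with_column k c ** identity_with_column k d) $ i $ j =
      identity_with_column k (d $ k *s c + d - d $ k *s axis k 1) $ i $ j" for i j
  proof -
    have "(identity_with_column k c ** identity_with_column k d) $ i $ j =
        (\<Sum>l\<in>UNIV. (if l = k then c $ i else of_bool (i = l)) * (if j = k then d $ l else of_bool (l = j)))"
      by (simp only: identity_with_column_def matrix_matrix_mult_def vec_lambda_beta)
    also have "\<dots> =
        (\<Sum>l\<in>UNIV. (if l = k then (c $ i - of_bool (i = k)) * (if j = k then d $ k else of_bool (k = j)) else 0)
         + (if l = i then (if j = k then d $ i else of_bool (i = j)) else 0))"
      by (intro sum.cong refl) (auto simp: algebra_simps)
    also have "\<dots> = identity_with_column k (d $ k *s c + d - d $ k *s axis k 1) $ i $ j"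
      by (simp only: sum.distrib) (auto simp: identity_with_column_def axis_def algebra_simps)
    finally show ?thesis .
  qed
  then show ?thesis
    by (simp add: vec_eq_iff)
qed

lemma det_identity_with_column: "det (identity_with_column k c) = c $ k"
  for k :: "'n::finite"
proof -
  have "mat 1 $ i $ j = (of_bool (i = j) :: complex)" for i j :: 'n
    by (simp add: mat_def)
  then show ?thesis
    using cramer_lemma[of k "mat 1" c] unfolding identity_with_column_def by (simp cong: if_cong)
qed

lemma matrix_vector_mult_axis: "A *v axis k 1 = column k A"
  for A :: "'a::semiring_1^'n^'m"
  by (simp add: matrix_vector_mult_def column_def axis_def vec_eq_iff if_distrib cong: if_cong)

lemma identity_with_column_vector_mult_axis:
  "identity_with_column k c *v axis j 1 = (if j = k then c else axis j 1)"
  unfolding matrix_vector_mult_axis by (auto simp: identity_with_column_def column_def axis_def vec_eq_iff)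

text \<open>
  Gaussian elimination by columns: as long as the pivot \<open>A $ k $ k\<close> is not zero, splitting off the
  identity matrix with column \<open>k\<close> of \<open>A\<close> turns that column of the remaining factor into a unit vector
  and keeps the finished ones. A zero pivot is first repaired by adding another row to row \<open>k\<close>.
\<close>

lemma invertible_induct_identity_with_column:
  fixes A :: "complex^'n^'n"
  assumes A: "det A \<noteq> 0"
    and gen: "\<And>k c. c $ k \<noteq> 0 \<Longrightarrow> P (identity_with_column k c)"
    and mult: "\<And>A B. det A \<noteq> 0 \<Longrightarrow> det B \<noteq> 0 \<Longrightarrow> P A \<Longrightarrow> P B \<Longrightarrow> P (A ** B)"
  shows "P A"
proof -
  have "\<forall>A. det A \<noteq> 0 \<longrightarrow> (\<forall>j. j \<notin> T \<longrightarrow> column j A = axis j 1) \<longrightarrow> P A" if "finite T" for T :: "'n set"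
    using that
  proof induction
    case empty
    have "P A" if "\<forall>j. column j A = axis j 1" for A
    proof -
      \<comment> \<open>the identity matrix is a generator for any choice of the column\<close>
      have "A = identity_with_column undefined (axis undefined 1)"
        using that by (auto simp: identity_with_column_def column_def axis_def vec_eq_iff)
      then show ?thesis
        using gen[of "axis undefined 1" undefined] by simp
    qed
    then show ?case
      by blast
  next
    case (insert k T)
    have pivot: "P A" if A: "det A \<noteq> 0" "\<And>j. j \<notin> insert k T \<Longrightarrow> column j A = axis j 1" "A $ k $ k \<noteq> 0" for A
    proof -
      define C where "C = identity_with_column k (column k A)"
      have C: "det C \<noteq> 0"
        using A(3) by (simp add: C_def det_identity_with_column column_def)
      then obtain C' where C': "C ** C' = mat 1" "C' ** C = mat 1"
        by (meson invertible_def invertible_det_nz)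
      have "column j (C' ** A) = axis j 1" if "j \<notin> T" for j
      proof -
        have "column j A = C *v axis j 1"
          using A(2)[of j] that by (auto simp: C_def identity_with_column_vector_mult_axis)
        then show ?thesis
          by (simp add: column_matrix_mult matrix_vector_mul_assoc C')
      qed
      moreover have A_eq: "A = C ** (C' ** A)"
        by (simp add: matrix_mul_assoc C')
      moreover have CA: "det (C' ** A) \<noteq> 0"
        using A(1) A_eq by (metis det_mul mult_zero_right)
      ultimately have "P (C' ** A)"
        using insert.IH by blast
      moreover have "P C"
        unfolding C_def by (rule gen) (use A(3) in \<open>simp add: column_def\<close>)
      ultimately have "P (C ** (C' ** A))"
        using mult C CA by blast
      then show "P A"
        using A_eq by simp
    qed
    have "P A" if A: "det A \<noteq> 0" "\<And>j. j \<notin> insert k T \<Longrightarrow> column j A = axis j 1" for A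
    proof (cases "A $ k $ k = 0")
      case True
      have "\<exists>i\<in>T. A $ i $ k \<noteq> 0"
      proof (rule ccontr)
        assume "\<not> ?thesis"
        then have zero: "A $ i $ k = 0" if "i \<in> insert k T" for i
          using that True by auto
        have "(A *v (axis k 1 - column k A)) $ i = 0" for i
        proof -
          have "A $ i $ j * A $ j $ k = (if j = i then A $ i $ k else 0)" for j
          proof (cases "j \<in> insert k T")
            case False
            then have "A $ i $ j = of_bool (i = j)"
              using A(2)[of j] by (auto simp: column_def axis_def vec_eq_iff)
            then show ?thesis
              by simp
          qed (use zero in auto)
          then have "(A *v column k A) $ i = A $ i $ k"
            by (simp add: matrix_vector_mult_def column_def)
          then show ?thesis
            by (simp add: matrix_vector_mult_diff_distrib matrix_vector_mult_axis column_def)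
        qed
        then have "A *v (axis k 1 - column k A) = 0"
          by (simp add: vec_eq_iff)
        then have "axis k 1 - column k A = 0"
          using A(1) unfolding full_rank_square_iff[symmetric] full_rank_def by blast
        then have "(axis k 1 - column k A) $ k = 0"
          by simp
        then show False
          using True by (simp add: column_def axis_def)
      qed
      then obtain i where i: "i \<in> T" "A $ i $ k \<noteq> 0"
        by blast
      then have ik: "i \<noteq> k"
        using insert.hyps by blast
      \<comment> \<open>\<open>E\<close> adds row \<open>i\<close> to row \<open>k\<close>, and \<open>F\<close> is its inverse\<close>
      define E F where "E = identity_with_column i (axis i 1 + axis k 1)"
        and "F = identity_with_column i (axis i 1 - axis k 1)"
      have dets: "det E \<noteq> 0" "det F \<noteq> 0"
        using ik by (simp_all add: E_def F_def det_identity_with_column axis_def)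
      have FE: "F ** E = mat 1"
        using ik unfolding E_def F_def identity_with_column_mult
        by (auto simp: identity_with_column_def vec_eq_iff axis_def mat_def)
      have "P (E ** A)"
      proof (rule pivot)
        show "det (E ** A) \<noteq> 0"
          using A dets by (simp add: det_mul)
        show "column j (E ** A) = axis j 1" if "j \<notin> insert k T" for j
        proof -
          have "j \<noteq> i"
            using that i by auto
          then show ?thesis
            by (simp add: column_matrix_mult A(2)[OF that] E_def identity_with_column_vector_mult_axis)
        qed
        have "(E ** A) $ k $ k = (\<Sum>l\<in>UNIV. E $ k $ l * A $ l $ k)"
          by (simp add: matrix_matrix_mult_def)
        also have "\<dots> = (\<Sum>l\<in>UNIV. if l = i then A $ i $ k else 0)"
          using ik True by (intro sum.cong refl) (auto simp: E_def identity_with_column_def axis_def)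
        finally show "(E ** A) $ k $ k \<noteq> 0"
          using i by simp
      qed
      moreover have "P F"
        unfolding F_def by (rule gen) (use ik in \<open>simp add: axis_def\<close>)
      ultimately have "P (F ** (E ** A))"
        using mult dets A by (simp add: det_mul)
      then show ?thesis
        by (simp add: matrix_mul_assoc FE)
    qed (use pivot A in blast)
    then show ?case
      by blast
  qed
  from this[of UNIV] show ?thesis
    using A by simp
qed

text \<open>
  A homomorphism to a commutative group kills shears, because a shear \<open>C\<close> is conjugate to its square
  \<open>C ** C\<close> by a diagonal matrix with entries 1 and 2. So it depends only on the determinant. A scalar
  matrix is a product of \<open>CARD('n)\<close> diagonal matrices that are conjugate to each other and have one
  entry different from 1, so its value on scalar matrices determines it.
\<close>

lemma multiplicative_eq_norm_det_power:
  fixes f :: "complex^'n^'n \<Rightarrow> real" and A :: "complex^'n^'n"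
  assumes pos: "\<And>A. det A \<noteq> 0 \<Longrightarrow> 0 < f A"
    and mult: "\<And>A B. det A \<noteq> 0 \<Longrightarrow> det B \<noteq> 0 \<Longrightarrow> f (A ** B) = f A * f B"
    and scalar: "\<And>z. z \<noteq> 0 \<Longrightarrow> f (mat z) = cmod z ^ (p * CARD('n))"
    and A: "det A \<noteq> 0"
  shows "f A = cmod (det A) ^ p"
proof -
  define d where "d k z = f (identity_with_column k (z *s axis k 1))" for k z
  have d_pos: "0 < d k z" if "z \<noteq> 0" for k z
    unfolding d_def by (rule pos) (use that in \<open>simp add: det_identity_with_column\<close>)
  have shear: "f (identity_with_column k c) = 1" if c: "c $ k = 1" for k c
  proof -
    let ?C = "identity_with_column k c" and ?D = "identity_with_column k (2 *s axis k 1)"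
    have eq: "?C ** ?D = ?D ** (?C ** ?C)"
      unfolding identity_with_column_mult
      by (rule arg_cong[where f="identity_with_column k"]) (simp add: vec_eq_iff c axis_def algebra_simps)
    have det: "det ?C \<noteq> 0" "det ?D \<noteq> 0"
      using c by (simp_all add: det_identity_with_column)
    have "f ?C * f ?D = f (?C ** ?D)"
      by (rule mult[OF det, symmetric])
    also have "\<dots> = f ?D * f (?C ** ?C)"
      unfolding eq using det by (intro mult) (simp_all add: det_mul)
    finally have "f ?C * f ?D = f ?D * (f ?C * f ?C)"
      using mult[OF det(1) det(1)] by simp
    then show ?thesis
      using pos[of ?C] pos[of ?D] c by (simp add: det_identity_with_column)
  qed
  have gen: "f (identity_with_column k c) = d k (c $ k)" if c: "c $ k \<noteq> 0" for k c
  proof -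
    have "identity_with_column k c = identity_with_column k (inverse (c $ k) *s c) ** identity_with_column k (c $ k *s axis k 1)"
      unfolding identity_with_column_mult
      by (rule arg_cong[where f="identity_with_column k"]) (use c in \<open>auto simp: vec_eq_iff axis_def\<close>)
    then show ?thesis
      using mult[of "identity_with_column k (inverse (c $ k) *s c)" "identity_with_column k (c $ k *s axis k 1)"] c
      by (simp add: det_identity_with_column shear d_def)
  qed
  have d_indep: "d k z = d l z" if z: "z \<noteq> 0" for k l z
  proof -
    let ?t = "Transposition.transpose k l"
    \<comment> \<open>the permutation matrix of a transposition conjugates the two diagonal matrices\<close>
    define S :: "complex^'n^'n" where "S = (\<chi> i j. of_bool (j = ?t i))"
    have S: "(S ** M) $ i $ j = M $ ?t i $ j" "(M ** S) $ i $ j = M $ i $ ?t j" for M i j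
    proof -
      have "S $ i $ l * M $ l $ j = (if l = ?t i then M $ l $ j else 0)"
        "M $ i $ l * S $ l $ j = (if l = ?t j then M $ i $ l else 0)" for l
        by (auto simp: S_def)
      then show "(S ** M) $ i $ j = M $ ?t i $ j" "(M ** S) $ i $ j = M $ i $ ?t j"
        by (simp_all add: matrix_matrix_mult_def)
    qed
    have "S ** S = mat 1"
      unfolding vec_eq_iff S by (auto simp: S_def mat_def) (metis transpose_involutory)
    then have detS: "det S \<noteq> 0"
      by (metis det_I det_mul mult_zero_right zero_neq_one)
    have det: "det (identity_with_column k (z *s axis k 1)) \<noteq> 0" for k :: 'n
      using z by (simp add: det_identity_with_column)
    have "S ** identity_with_column k (z *s axis k 1) = identity_with_column l (z *s axis l 1) ** S"
      by (auto simp: vec_eq_iff S identity_with_column_def axis_def Transposition.transpose_def)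
    then have "f S * d k z = d l z * f S"
      using mult[OF detS det[of k]] mult[OF det[of l] detS] unfolding d_def by metis
    then show ?thesis
      using pos[OF detS] by simp
  qed
  have d_eq: "d k z = cmod z ^ p" if z: "z \<noteq> 0" for k z
  proof -
    define D :: "'n set \<Rightarrow> complex^'n^'n" where "D S = (\<chi> i j. if i = j then if i \<in> S then z else 1 else 0)" for S
    have detD: "det (D S) \<noteq> 0" for S
      by (subst det_diagonal) (use z in \<open>auto simp: D_def\<close>)
    have "f (D S) = d k z ^ card S" if "finite S" for S
      using that
    proof induction
      case empty
      have "D {} = identity_with_column k (axis k 1)"
        by (auto simp: D_def identity_with_column_def vec_eq_iff axis_def)
      then show ?case
        using shear[of "axis k 1" k] by simp
    next
      case (insert l S)
      have "(D S ** identity_with_column l (z *s axis l 1)) $ i $ j = D (insert l S) $ i $ j" for i j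
      proof -
        have "D S $ i $ m * identity_with_column l (z *s axis l 1) $ m $ j =
          (if m = i then D (insert l S) $ i $ j else 0)" for m
          using insert.hyps by (auto simp: D_def identity_with_column_def axis_def)
        then show ?thesis
          by (simp add: matrix_matrix_mult_def)
      qed
      then have "D (insert l S) = D S ** identity_with_column l (z *s axis l 1)"
        by (simp add: vec_eq_iff)
      then have "f (D (insert l S)) = f (D S) * d l z"
        using mult[OF detD] z by (simp add: det_identity_with_column d_def)
      then show ?case
        using insert d_indep[OF z, of l k] by simp
    qed
    from this[of UNIV] have "f (D UNIV) = d k z ^ CARD('n)"
      by simp
    moreover have "D UNIV = mat z"
      by (simp add: D_def mat_def vec_eq_iff)
    ultimately have "d k z ^ CARD('n) = (cmod z ^ p) ^ CARD('n)"
      using scalar[OF z] by (simp add: power_mult)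
    then show ?thesis
      using d_pos[OF z, of k] power_eq_iff_eq_base[of "CARD('n)" "d k z" "cmod z ^ p"] by simp
  qed
  show ?thesis
  proof (rule invertible_induct_identity_with_column[where P = "\<lambda>A. f A = cmod (det A) ^ p", OF A])
    show "f (identity_with_column k c) = cmod (det (identity_with_column k c)) ^ p" if "c $ k \<noteq> 0" for k c
      using that by (simp add: gen d_eq det_identity_with_column)
    show "f (A ** B) = cmod (det (A ** B)) ^ p" if "det A \<noteq> 0" "det B \<noteq> 0"
      "f A = cmod (det A) ^ p" "f B = cmod (det B) ^ p" for A B
      using that by (simp add: mult det_mul norm_mult power_mult_distrib)
  qed
qed

section \<open>Lebesgue measure under linear bijections\<close>

lemma nn_integral_lborel_translate:
  fixes g :: "'a::euclidean_space \<Rightarrow> ennreal"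
  assumes "g \<in> borel_measurable borel"
  shows "(\<integral>\<^sup>+x. g (t + x) \<partial>lborel) = (\<integral>\<^sup>+x. g x \<partial>lborel)"
  using assms by (subst lborel_distr_plus[of t, symmetric]) (simp add: nn_integral_distr)

lemma nn_integral_lborel_scaleR:
  fixes g :: "'a::euclidean_space \<Rightarrow> ennreal"
  assumes [measurable]: "g \<in> borel_measurable borel" and c: "c \<noteq> 0"
  shows "(\<integral>\<^sup>+x. g x \<partial>lborel) = ennreal (\<bar>c\<bar> ^ DIM('a)) * (\<integral>\<^sup>+x. g (c *\<^sub>R x) \<partial>lborel)"
  by (subst lborel_affine[OF c, of 0])
    (simp add: nn_integral_density nn_integral_distr nn_integral_cmult)

lemma nn_integral_lborel_reflect:
  fixes g :: "'a::euclidean_space \<Rightarrow> ennreal"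
  assumes [measurable]: "g \<in> borel_measurable borel"
  shows "(\<integral>\<^sup>+x. g (t - x) \<partial>lborel) = (\<integral>\<^sup>+x. g x \<partial>lborel)"
  using nn_integral_lborel_scaleR[of "\<lambda>x. g (t + x)" "-1"] nn_integral_lborel_translate[of g t]
  by simp

text \<open>
  For an injective linear \<open>f\<close> this is the modulus of its determinant; the quotient avoids
  coordinates.
\<close>

definition linear_scale_factor :: "('a::euclidean_space \<Rightarrow> 'a) \<Rightarrow> real" where
  "linear_scale_factor f = measure lborel (cball (0::'a) 1) / measure lborel (f -` cball 0 1)"

lemma emeasure_unit_ball:
  "0 < measure lborel (cball (0::'a::euclidean_space) 1)"
  "emeasure lborel (cball (0::'a) 1) = ennreal (measure lborel (cball (0::'a) 1))"
  using emeasure_lborel_cball_finite[of "0::'a" 1]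
  by (simp_all add: content_cball_pos emeasure_eq_ennreal_measure)

lemma borel_measurable_indicator_ball:
  "(indicator (cball 0 1) :: 'a::euclidean_space \<Rightarrow> ennreal) \<in> borel_measurable borel"
  by (intro borel_measurable_indicator borel_closed closed_cball)

text \<open>
  The image of Lebesgue measure under \<open>f\<close> is translation invariant, so it is a multiple of Lebesgue
  measure, and the unit ball shows which one.
\<close>

lemma linear_scale_factor:
  fixes f :: "'a::euclidean_space \<Rightarrow> 'a"
  assumes f: "linear f" "inj f"
  shows "0 < linear_scale_factor f"
    and "g \<in> borel_measurable borel \<Longrightarrow>
      (\<integral>\<^sup>+x. g x \<partial>lborel) = ennreal (linear_scale_factor f) * (\<integral>\<^sup>+x. g (f x) \<partial>lborel)"
proof -
  have [measurable]: "f \<in> borel_measurable borel"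
    using f(1) by (intro borel_measurable_continuous_onI linear_continuous_on linear_conv_bounded_linear[THEN iffD1])
  obtain f' where f': "linear f'" "\<And>x. f (f' x) = x" "\<And>x. f' (f x) = x"
    using linear_injective_isomorphism[OF f] by blast
  \<comment> \<open>uniqueness of a translation invariant measure, by evaluating a double integral in both orders\<close>
  have cross: "(\<integral>\<^sup>+x. g x \<partial>lborel) * (\<integral>\<^sup>+y. h (f y) \<partial>lborel) =
      (\<integral>\<^sup>+x. h x \<partial>lborel) * (\<integral>\<^sup>+y. g (f y) \<partial>lborel)"
    if [measurable]: "g \<in> borel_measurable borel" "h \<in> borel_measurable borel" for g h :: "'a \<Rightarrow> ennreal"
  proof -
    have "(\<integral>\<^sup>+y. h (f y) \<partial>lborel) = (\<integral>\<^sup>+y. h (f y + x) \<partial>lborel)" for x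
      using nn_integral_lborel_translate[of "\<lambda>y. h (f y)" "f' x"]
      by (simp add: linear_add[OF f(1)] f' add.commute)
    then have "(\<integral>\<^sup>+x. g x \<partial>lborel) * (\<integral>\<^sup>+y. h (f y) \<partial>lborel) =
        (\<integral>\<^sup>+x. (\<integral>\<^sup>+y. g x * h (f y + x) \<partial>lborel) \<partial>lborel)"
      by (simp add: nn_integral_cmult nn_integral_multc[symmetric])
    also have "\<dots> = (\<integral>\<^sup>+y. (\<integral>\<^sup>+x. g x * h (f y + x) \<partial>lborel) \<partial>lborel)"
      by (rule lborel_pair.Fubini'[symmetric]) measurable
    also have "\<dots> = (\<integral>\<^sup>+y. (\<integral>\<^sup>+x. g (x - f y) * h x \<partial>lborel) \<partial>lborel)"
    proof (rule nn_integral_cong)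
      show "(\<integral>\<^sup>+x. g x * h (f y + x) \<partial>lborel) = (\<integral>\<^sup>+x. g (x - f y) * h x \<partial>lborel)" for y
        using nn_integral_lborel_translate[of "\<lambda>x. g (x - f y) * h x" "f y"] by simp
    qed
    also have "\<dots> = (\<integral>\<^sup>+x. (\<integral>\<^sup>+y. g (x - f y) * h x \<partial>lborel) \<partial>lborel)"
      by (rule lborel_pair.Fubini') measurable
    also have "\<dots> = (\<integral>\<^sup>+x. (\<integral>\<^sup>+y. g (f y) \<partial>lborel) * h x \<partial>lborel)"
    proof (rule nn_integral_cong)
      show "(\<integral>\<^sup>+y. g (x - f y) * h x \<partial>lborel) = (\<integral>\<^sup>+y. g (f y) \<partial>lborel) * h x" for x
        using nn_integral_lborel_reflect[of "\<lambda>y. g (f y)" "f' x"]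
        by (simp add: nn_integral_multc linear_diff[OF f(1)] f')
    qed
    also have "\<dots> = (\<integral>\<^sup>+x. h x \<partial>lborel) * (\<integral>\<^sup>+y. g (f y) \<partial>lborel)"
      by (simp add: nn_integral_cmult mult.commute[of _ "h _"] nn_integral_multc)
    finally show ?thesis .
  qed
  let ?h = "indicator (cball 0 1) :: 'a \<Rightarrow> ennreal"
  define V v where "V = measure lborel (cball (0::'a) 1)" and "v = measure lborel (f -` cball 0 1)"
  have V: "0 < V" "(\<integral>\<^sup>+x. ?h x \<partial>lborel) = ennreal V"
    using emeasure_unit_ball[where 'a='a] by (simp_all add: V_def)
  have preimage: "f -` cball 0 1 = f' ` cball 0 1"
  proof (intro set_eqI iffI)
    show "x \<in> f' ` cball 0 1" if "x \<in> f -` cball 0 1" for x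
      using that f'(3)[of x] by (metis image_eqI vimageE)
  qed (auto simp: f')
  have "compact (f' ` cball (0::'a) 1)"
    using f'(1) by (intro compact_continuous_image linear_continuous_on compact_cball)
      (simp add: linear_conv_bounded_linear)
  then have "emeasure lborel (f -` cball 0 1) < \<infinity>"
    unfolding preimage by (rule emeasure_compact_finite)
  moreover have "(\<integral>\<^sup>+x. ?h (f x) \<partial>lborel) = emeasure lborel (f -` cball 0 1)"
    by (subst nn_integral_indicator[symmetric]) (auto simp: indicator_def intro!: nn_integral_cong
        measurable_sets_borel[of f borel])
  ultimately have v: "(\<integral>\<^sup>+x. ?h (f x) \<partial>lborel) = ennreal v"
    by (simp add: v_def emeasure_eq_ennreal_measure less_top[symmetric])
  have "v \<noteq> 0"
  proof
    assume "v = 0"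
    then show False
      using cross[of "\<lambda>_. 1", OF _ borel_measurable_indicator_ball] V v by (simp add: ennreal_mult_top)
  qed
  then have v0: "0 < v"
    by (simp add: v_def zero_less_measure_iff order_less_le)
  show pos: "0 < linear_scale_factor f"
    using V v0 by (simp add: linear_scale_factor_def V_def v_def)
  assume g: "g \<in> borel_measurable borel"
  have one: "ennreal v * ennreal (inverse v) = 1"
    using v0 by (simp flip: ennreal_mult)
  have "(\<integral>\<^sup>+x. g x \<partial>lborel) = ((\<integral>\<^sup>+x. g x \<partial>lborel) * ennreal v) * ennreal (inverse v)"
    by (simp add: mult.assoc one)
  also have "(\<integral>\<^sup>+x. g x \<partial>lborel) * ennreal v = ennreal V * (\<integral>\<^sup>+x. g (f x) \<partial>lborel)"
    using cross[OF g borel_measurable_indicator_ball] V v by simp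
  also have "\<dots> * ennreal (inverse v) = ennreal (V * inverse v) * (\<integral>\<^sup>+x. g (f x) \<partial>lborel)"
    using V v0 by (simp add: ennreal_mult mult_ac)
  finally show "(\<integral>\<^sup>+x. g x \<partial>lborel) = ennreal (linear_scale_factor f) * (\<integral>\<^sup>+x. g (f x) \<partial>lborel)"
    by (simp add: linear_scale_factor_def V_def v_def divide_inverse)
qed

lemma linear_scale_factor_eqI:
  fixes f :: "'a::euclidean_space \<Rightarrow> 'a"
  assumes f: "linear f" "inj f" and c: "0 \<le> c"
    and eq: "(\<integral>\<^sup>+x. indicator (cball 0 1) x \<partial>(lborel :: 'a measure)) =
      ennreal c * (\<integral>\<^sup>+x. indicator (cball 0 1) (f x) \<partial>lborel)"
  shows "linear_scale_factor f = c"
proof -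
  let ?I = "\<integral>\<^sup>+x. indicator (cball 0 1) (f x) \<partial>lborel"
  have *: "ennreal (linear_scale_factor f) * ?I = ennreal c * ?I"
    using linear_scale_factor(2)[OF f borel_measurable_indicator_ball] eq by simp
  obtain V where V: "0 < V" "ennreal c * ?I = ennreal V"
  proof (rule that)
    show "0 < measure lborel (cball (0::'a) 1)"
      by (rule emeasure_unit_ball)
    show "ennreal c * ?I = ennreal (measure lborel (cball (0::'a) 1))"
      using eq emeasure_unit_ball(2)[where 'a='a] by simp
  qed
  then have I0: "?I \<noteq> 0"
    by auto
  have "c \<noteq> 0"
    using V by auto
  then have "0 < c"
    using c by simp
  then have "?I \<noteq> \<top>"
    using V by (auto simp: ennreal_mult_top)
  then obtain i where i: "?I = ennreal i" "0 \<le> i"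
    by (cases ?I) auto
  with I0 have "0 < i"
    by (auto simp: order_less_le)
  moreover have "ennreal (linear_scale_factor f * i) = ennreal (c * i)"
    using * i c linear_scale_factor(1)[OF f] by (simp add: ennreal_mult)
  ultimately show ?thesis
    using c linear_scale_factor(1)[OF f] by simp
qed

lemma nn_integral_lborel_isometry:
  fixes f :: "'a::euclidean_space \<Rightarrow> 'a"
  assumes f: "linear f" "\<And>x. norm (f x) = norm x" and g: "g \<in> borel_measurable borel"
  shows "(\<integral>\<^sup>+x. g (f x) \<partial>lborel) = (\<integral>\<^sup>+x. g x \<partial>lborel)"
proof -
  have inj: "inj f"
    using f by (metis linear_injective_0 norm_eq_zero)
  have "linear_scale_factor f = 1"
    by (rule linear_scale_factor_eqI[OF f(1) inj]) (simp_all add: indicator_def f(2))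
  then show ?thesis
    using linear_scale_factor(2)[OF f(1) inj g] by simp
qed

lemma linear_scale_factor_comp:
  fixes f h :: "'a::euclidean_space \<Rightarrow> 'a"
  assumes "linear f" "inj f" "linear h" "inj h"
  shows "linear_scale_factor (\<lambda>x. f (h x)) = linear_scale_factor f * linear_scale_factor h"
proof -
  have [measurable]: "f \<in> borel_measurable borel"
    using assms by (intro borel_measurable_continuous_onI linear_continuous_on linear_conv_bounded_linear[THEN iffD1])
  have ball_f: "(\<lambda>x. indicator (cball 0 1) (f x) :: ennreal) \<in> borel_measurable borel"
    by (rule measurable_compose[OF _ borel_measurable_indicator_ball]) measurable
  show ?thesis
  proof (rule linear_scale_factor_eqI)
    show "linear (\<lambda>x. f (h x))" "inj (\<lambda>x. f (h x))"
      using assms linear_compose[of h f] inj_compose[of f h] by (simp_all add: o_def)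
    show "0 \<le> linear_scale_factor f * linear_scale_factor h"
      using linear_scale_factor(1)[OF assms(1,2)] linear_scale_factor(1)[OF assms(3,4)] by simp
    show "(\<integral>\<^sup>+x. indicator (cball 0 1) x \<partial>(lborel :: 'a measure)) = ennreal (linear_scale_factor f * linear_scale_factor h) *
        (\<integral>\<^sup>+x. indicator (cball 0 1) (f (h x)) \<partial>lborel)"
      using linear_scale_factor(2)[OF assms(1,2) borel_measurable_indicator_ball]
        linear_scale_factor(2)[OF assms(3,4) ball_f]
        linear_scale_factor(1)[OF assms(1,2)] linear_scale_factor(1)[OF assms(3,4)]
      by (simp add: ennreal_mult mult.assoc)
  qed
qed

lemma linear_matrix_mult_left: "linear (\<lambda>X :: complex^'r^'m. (A :: complex^'m^'n) ** X)"
  by (rule linearI) (simp_all add: matrix_matrix_mult_def vec_eq_iff scaleR_sum_right sum.distrib distrib_left)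

lemma linear_matrix_mult_right: "linear (\<lambda>X :: complex^'r^'m. X ** (A :: complex^'n^'r))"
  by (rule linearI) (simp_all add: matrix_matrix_mult_def vec_eq_iff scaleR_sum_right sum.distrib distrib_right)

lemma inj_matrix_mult_left: "inj (\<lambda>X :: complex^'r^'m. A ** X)" if "det A \<noteq> 0"
proof -
  from that obtain A' where "A' ** A = mat 1"
    using invertible_det_nz[of A] unfolding invertible_def by blast
  then have "A' ** (A ** X) = X" for X :: "complex^'r^'m"
    by (simp add: matrix_mul_assoc)
  then show ?thesis
    by (rule inj_on_inverseI[where g = "\<lambda>Y. A' ** Y"])
qed

lemma inj_matrix_mult_right: "inj (\<lambda>X :: complex^'r^'m. X ** A)" if "det A \<noteq> 0"
proof -
  from that obtain A' where "A ** A' = mat 1"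
    using invertible_det_nz[of A] unfolding invertible_def by blast
  then have "X ** A ** A' = X" for X :: "complex^'r^'m"
    by (simp add: matrix_mul_assoc[symmetric])
  then show ?thesis
    by (rule inj_on_inverseI[where g = "\<lambda>Y. Y ** A'"])
qed

lemma mat_mult_entry: "(mat z ** X) $ i $ j = z * X $ i $ j" "(X ** mat z) $ i $ j = X $ i $ j * (z::complex)"
  by (simp_all add: matrix_matrix_mult_def mat_def if_distrib if_distribR cong: if_cong)

lemma norm_mat_mult:
  fixes X :: "complex^'r^'m"
  shows "norm (mat z ** X) = cmod z * norm X" "norm (X ** mat z) = cmod z * norm X"
  by (simp_all add: norm_vec_def mat_mult_entry norm_mult L2_set_right_distrib mult.commute[of _ "cmod z"])

lemma linear_scale_factor_of_norm_scaling:
  fixes f :: "'a::euclidean_space \<Rightarrow> 'a"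
  assumes "linear f" "inj f" "\<And>x. norm (f x) = s * norm x" "0 < s"
  shows "linear_scale_factor f = s ^ DIM('a)"
proof (rule linear_scale_factor_eqI[OF assms(1,2)])
  have "indicator (cball 0 1) (f x) = (indicator (cball 0 1) (s *\<^sub>R x) :: ennreal)" for x
    using assms(3,4) by (simp add: indicator_def)
  then show "(\<integral>\<^sup>+x. indicator (cball 0 1) x \<partial>(lborel :: 'a measure)) =
      ennreal (s ^ DIM('a)) * (\<integral>\<^sup>+x. indicator (cball 0 1) (f x) \<partial>lborel)"
    using nn_integral_lborel_scaleR[OF borel_measurable_indicator_ball[where 'a='a], of s] assms(4) by simp
qed (use assms in simp)

text \<open>
  The scale factor is multiplicative in \<open>B\<close>, and for a scalar matrix it is a power of the modulus with
  exponent \<open>2 * CARD('r) * CARD('m)\<close>, the real dimension of the space.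
\<close>

lemma nn_integral_matrix_mult_left:
  fixes g :: "complex^'r^'m \<Rightarrow> ennreal" and B :: "complex^'m^'m"
  assumes B: "det B \<noteq> 0" and g: "g \<in> borel_measurable borel"
  shows "(\<integral>\<^sup>+X. g X \<partial>lborel) = ennreal (cmod (det B) ^ (2 * CARD('r))) * (\<integral>\<^sup>+X. g (B ** X) \<partial>lborel)"
proof -
  define f where "f A = linear_scale_factor (\<lambda>X :: complex^'r^'m. A ** X)" for A :: "complex^'m^'m"
  have "f B = cmod (det B) ^ (2 * CARD('r))"
  proof (rule multiplicative_eq_norm_det_power[OF _ _ _ B])
    show "0 < f A" if "det A \<noteq> 0" for A
      unfolding f_def using that by (intro linear_scale_factor linear_matrix_mult_left inj_matrix_mult_left)
    show "f (A ** C) = f A * f C" if "det A \<noteq> 0" "det C \<noteq> 0" for A C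
      unfolding f_def
      using linear_scale_factor_comp[OF linear_matrix_mult_left inj_matrix_mult_left[OF that(1)]
          linear_matrix_mult_left inj_matrix_mult_left[OF that(2)]]
      by (simp add: matrix_mul_assoc)
    show "f (mat z) = cmod z ^ (2 * CARD('r) * CARD('m))" if z: "z \<noteq> 0" for z
    proof -
      have "det (mat z :: complex^'m^'m) \<noteq> 0"
        by (subst det_diagonal) (use z in \<open>auto simp: mat_def\<close>)
      then have "f (mat z) = cmod z ^ DIM(complex^'r^'m)"
        unfolding f_def using z
        by (intro linear_scale_factor_of_norm_scaling linear_matrix_mult_left inj_matrix_mult_left norm_mat_mult) auto
      then show ?thesis
        by (simp add: ac_simps)
    qed
  qed
  then show ?thesis
    unfolding f_def using linear_scale_factor(2)[OF linear_matrix_mult_left inj_matrix_mult_left[OF B] g] by simp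
qed

lemma nn_integral_matrix_mult_right:
  fixes g :: "complex^'r^'m \<Rightarrow> ennreal" and B :: "complex^'r^'r"
  assumes B: "det B \<noteq> 0" and g: "g \<in> borel_measurable borel"
  shows "(\<integral>\<^sup>+X. g X \<partial>lborel) = ennreal (cmod (det B) ^ (2 * CARD('m))) * (\<integral>\<^sup>+X. g (X ** B) \<partial>lborel)"
proof -
  define f where "f A = linear_scale_factor (\<lambda>X :: complex^'r^'m. X ** A)" for A :: "complex^'r^'r"
  have "f B = cmod (det B) ^ (2 * CARD('m))"
  proof (rule multiplicative_eq_norm_det_power[OF _ _ _ B])
    show "0 < f A" if "det A \<noteq> 0" for A
      unfolding f_def using that by (intro linear_scale_factor linear_matrix_mult_right inj_matrix_mult_right)
    show "f (A ** C) = f A * f C" if "det A \<noteq> 0" "det C \<noteq> 0" for A C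
      unfolding f_def
      using linear_scale_factor_comp[OF linear_matrix_mult_right inj_matrix_mult_right[OF that(2)]
          linear_matrix_mult_right inj_matrix_mult_right[OF that(1)]]
      by (simp add: matrix_mul_assoc mult.commute)
    show "f (mat z) = cmod z ^ (2 * CARD('m) * CARD('r))" if z: "z \<noteq> 0" for z
    proof -
      have "det (mat z :: complex^'r^'r) \<noteq> 0"
        by (subst det_diagonal) (use z in \<open>auto simp: mat_def\<close>)
      then have "f (mat z) = cmod z ^ DIM(complex^'r^'m)"
        unfolding f_def using z
        by (intro linear_scale_factor_of_norm_scaling linear_matrix_mult_right inj_matrix_mult_right norm_mat_mult) auto
      then show ?thesis
        by (simp add: ac_simps)
    qed
  qed
  then show ?thesis
    unfolding f_def using linear_scale_factor(2)[OF linear_matrix_mult_right inj_matrix_mult_right[OF B] g] by simp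
qed

lemma norm_stiefel_mult: "norm (H ** X) = norm X" if "H \<in> stiefel"
  using that by (simp add: norm_eq_sqrt_inner inner_matrix_mult_left matrix_mul_assoc stiefel_def)

lemma norm_mult_unitary: "norm (X ** Q) = norm X" if "Q \<in> stiefel" for Q :: "complex^'r^'r"
  using norm_stiefel_mult[OF ctranspose_in_stiefel[OF that], of "ctranspose X"]
  by (metis ctranspose_mult norm_ctranspose)

lemma nn_integral_unitary_mult:
  fixes g :: "complex^'r^'m \<Rightarrow> ennreal" and U :: "complex^'m^'m" and Q :: "complex^'r^'r"
  assumes U: "U \<in> stiefel" and Q: "Q \<in> stiefel" and g: "g \<in> borel_measurable borel"
  shows "(\<integral>\<^sup>+X. g (U ** X ** Q) \<partial>lborel) = (\<integral>\<^sup>+X. g X \<partial>lborel)"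
proof (rule nn_integral_lborel_isometry[where f = "\<lambda>X. U ** X ** Q", OF _ _ g])
  show "linear (\<lambda>X :: complex^'r^'m. U ** X ** Q)"
    using linear_compose[OF linear_matrix_mult_left linear_matrix_mult_right] by (simp add: o_def)
qed (simp add: norm_stiefel_mult[OF U] norm_mult_unitary[OF Q])

section \<open>Rank deficient matrices form a null set\<close>

text \<open>
  Up to inversion of \<open>t\<close> these are roots of the polynomial \<open>s \<mapsto> det (mat 1 + mat s ** K)\<close>, which
  is 1 at 0.
\<close>

lemma finite_singular_shifts:
  fixes K :: "complex^'n^'n"
  shows "finite {t :: real. det (mat (of_real t) + K) = 0}"
proof -
  define p where "p = det (\<chi> i j. [: of_bool (i = j), K $ i $ j :])"
  have entry: "(mat 1 :: complex^'n^'n) $ i $ j = of_bool (i = j)" for i j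
    by (simp add: mat_def)
  have p: "poly p s = det (mat 1 + mat s ** K)" for s
    unfolding p_def det_def
    by (simp add: poly_sum poly_prod entry mat_mult_entry)
  have "poly p 0 = 1"
  proof -
    have "mat 0 ** K = 0"
      by (simp add: vec_eq_iff mat_mult_entry)
    then show ?thesis
      by (simp add: p)
  qed
  then have "p \<noteq> 0"
    by auto
  have "{t :: real. det (mat (of_real t) + K) = 0} \<subseteq> insert 0 ((\<lambda>s. 1 / Re s) ` {s. poly p s = 0})"
  proof
    fix t :: real
    assume t: "t \<in> {t. det (mat (of_real t) + K) = 0}"
    have "1 / Re (of_real (1 / t)) = t" if "t \<noteq> 0"
      using that by simp
    moreover have "poly p (of_real (1 / t)) = 0" if "t \<noteq> 0"
    proof -
      have "mat 1 + mat (of_real (1 / t)) ** K = mat (of_real (1 / t)) ** (mat (of_real t) + K)"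
        using that by (simp add: vec_eq_iff mat_mult_entry) (simp add: mat_def field_simps)
      then show ?thesis
        using t by (simp add: p det_mul)
    qed
    ultimately show "t \<in> insert 0 ((\<lambda>s. 1 / Re s) ` {s. poly p s = 0})"
      using image_eqI[of t "\<lambda>s. 1 / Re s" "of_real (1 / t)" "{s. poly p s = 0}"] by fastforce
  qed
  then show ?thesis
    by (rule finite_subset) (intro finite.insertI finite_imageI poly_roots_finite \<open>p \<noteq> 0\<close>)
qed

text \<open>
  On each line in the direction of a matrix \<open>E\<close> with orthonormal columns only finitely many points
  have deficient rank, since there \<open>ctranspose E ** X\<close> is singular. Fubini and translation invariance
  turn this into a statement on the measure of the set.
\<close>

lemma AE_full_rank:
  assumes "CARD('r) \<le> CARD('m)"
  shows "AE X in (lborel :: (complex^'r^'m) measure). full_rank X"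
proof -
  obtain E :: "complex^'r^'m" where E: "E \<in> stiefel"
    using stiefel_nonempty[OF assms] by blast
  define N where "N = {X :: complex^'r^'m. \<not> full_rank X}"
  have "N = - {X. full_rank X}"
    by (auto simp: N_def)
  then have N [measurable]: "N \<in> sets borel"
    by (simp only:) (intro borel_closed closed_Compl open_full_rank)
  have line: "(\<integral>\<^sup>+t. indicator {0..1} t * indicator N (t *\<^sub>R E + X) \<partial>lborel) = 0" for X
  proof -
    have "{t. t *\<^sub>R E + X \<in> N} \<subseteq> {t. det (mat (of_real t) + ctranspose E ** X) = 0}"
    proof
      fix t
      assume "t \<in> {t. t *\<^sub>R E + X \<in> N}"
      then have "\<not> full_rank (ctranspose E ** (t *\<^sub>R E + X))"
        using full_rank_mult_right by (auto simp: N_def)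
      moreover have "ctranspose E ** (t *\<^sub>R E) = t *\<^sub>R (ctranspose E ** E)"
        using linear_scale[OF linear_matrix_mult_left] .
      then have "ctranspose E ** (t *\<^sub>R E) = mat (of_real t)"
        using E by (simp add: stiefel_def) (simp add: mat_def vec_eq_iff scaleR_conv_of_real[where 'a=complex])
      ultimately show "t \<in> {t. det (mat (of_real t) + ctranspose E ** X) = 0}"
        by (simp add: matrix_add_ldistrib full_rank_square_iff)
    qed
    then have "finite {t. t *\<^sub>R E + X \<in> N}"
      using finite_singular_shifts finite_subset by blast
    then have ae: "AE t in lborel. t \<notin> {t. t *\<^sub>R E + X \<in> N}"
      by (intro AE_not_in finite_imp_null_set_lborel)
    have "(\<integral>\<^sup>+t. indicator {0..1} t * indicator N (t *\<^sub>R E + X) \<partial>lborel) = (\<integral>\<^sup>+(t::real). 0 \<partial>lborel)"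
      by (rule nn_integral_cong_AE) (use ae in \<open>auto simp: indicator_def\<close>)
    then show ?thesis
      by simp
  qed
  have "emeasure lborel N = (\<integral>\<^sup>+t. indicator {0..1::real} t * emeasure lborel N \<partial>lborel)"
    by (simp add: nn_integral_multc)
  also have "\<dots> = (\<integral>\<^sup>+t. \<integral>\<^sup>+X. indicator {0..1} t * indicator N (t *\<^sub>R E + X) \<partial>lborel \<partial>lborel)"
    using nn_integral_lborel_translate[of "indicator N"]
    by (intro nn_integral_cong) (simp add: nn_integral_cmult)
  also have "\<dots> = (\<integral>\<^sup>+X. \<integral>\<^sup>+t. indicator {0..1} t * indicator N (t *\<^sub>R E + X) \<partial>lborel \<partial>lborel)"
    by (rule lborel_pair.Fubini'[symmetric]) measurable
  also have "\<dots> = 0"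
    by (simp add: line)
  finally have "N \<in> null_sets lborel"
    by auto
  then show ?thesis
    by (rule AE_I') (auto simp: N_def)
qed

section \<open>The invariant probability measure on the Stiefel manifold\<close>

lemma borel_measurable_matrix_mult [measurable (raw)]:
  fixes f :: "'a \<Rightarrow> complex^'n^'m" and g :: "'a \<Rightarrow> complex^'p^'n"
  assumes "f \<in> borel_measurable M" "g \<in> borel_measurable M"
  shows "(\<lambda>x. f x ** g x) \<in> borel_measurable M"
  using assms by (rule borel_measurable_continuous_Pair) (intro continuous_intros)

lemma borel_measurable_ctranspose [measurable (raw)]:
  fixes f :: "'a \<Rightarrow> complex^'n^'m"
  assumes "f \<in> borel_measurable M"
  shows "(\<lambda>x. ctranspose (f x)) \<in> borel_measurable M"
  using assms by (rule borel_measurable_continuous_on[rotated]) (intro continuous_intros)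

lemma borel_measurable_det [measurable (raw)]:
  fixes f :: "'a \<Rightarrow> complex^'n^'n"
  assumes "f \<in> borel_measurable M"
  shows "(\<lambda>x. det (f x)) \<in> borel_measurable M"
  using assms by (rule borel_measurable_continuous_on[rotated]) (intro continuous_intros)

lemma stiefel_in_borel: "stiefel \<in> sets borel"
  by (intro borel_compact compact_stiefel)

lemma measurable_from_stiefel:
  assumes "sets \<mu> = sets (restrict_space borel stiefel)" "f \<in> measurable borel N"
  shows "f \<in> measurable \<mu> N"
  using measurable_restrict_space1[OF assms(2), of stiefel] measurable_cong_sets[OF assms(1) refl] by blast

lemma measurable_into_stiefel:
  assumes "sets \<mu> = sets (restrict_space borel stiefel)" "f \<in> borel_measurable N"
    and "\<And>x. x \<in> space N \<Longrightarrow> f x \<in> stiefel"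
  shows "f \<in> measurable N \<mu>"
proof -
  have "f \<in> measurable N (restrict_space borel stiefel)"
    using assms by (intro measurable_restrict_space2) auto
  then show ?thesis
    using measurable_cong_sets[OF refl assms(1)] by blast
qed

lemma space_stiefel:
  assumes "sets \<mu> = sets (restrict_space borel stiefel)"
  shows "space \<mu> = stiefel"
  using sets_eq_imp_space_eq[OF assms] by (simp add: space_restrict_space)

text \<open>
  Test functions defined on all matrices suffice, as the Stiefel manifold is a Borel set. So
  integrals below never involve the subspace sigma-algebra.
\<close>

lemma stiefel_measure_eqI:
  fixes \<mu> \<nu> :: "(complex^'r^'m) measure"
  assumes \<mu>: "sets \<mu> = sets (restrict_space borel stiefel)"
    and \<nu>: "sets \<nu> = sets (restrict_space borel stiefel)"
    and eq: "\<And>F :: complex^'r^'m \<Rightarrow> ennreal. F \<in> borel_measurable borel \<Longrightarrow>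
      (\<integral>\<^sup>+X. F X \<partial>\<mu>) = (\<integral>\<^sup>+X. F X \<partial>\<nu>)"
  shows "\<mu> = \<nu>"
proof (rule measure_eqI)
  fix A assume A: "A \<in> sets \<mu>"
  then have "A \<in> sets borel"
    unfolding \<mu> by (subst (asm) sets_restrict_space_iff) (simp_all add: stiefel_in_borel)
  then show "emeasure \<mu> A = emeasure \<nu> A"
    using eq[of "indicator A"] A by (simp add: \<mu> \<nu>)
qed (simp add: \<mu> \<nu>)

lemma is_stiefel_measure_iff:
  fixes \<mu> :: "(complex^'r^'m) measure"
  assumes sets: "sets \<mu> = sets (restrict_space borel stiefel)"
  shows "is_stiefel_measure \<mu> \<longleftrightarrow> prob_space \<mu> \<and>
    (\<forall>U \<in> stiefel. \<forall>Q \<in> stiefel. \<forall>F \<in> borel_measurable borel.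
      (\<integral>\<^sup>+X. F (U ** X ** Q) \<partial>\<mu>) = (\<integral>\<^sup>+X. (F X :: ennreal) \<partial>\<mu>))"
proof -
  have trans: "(\<lambda>X. U ** X ** Q) \<in> measurable \<mu> \<mu>" if "U \<in> stiefel" "Q \<in> stiefel" for U Q
  proof (rule measurable_into_stiefel[OF sets])
    show "(\<lambda>X. U ** X ** Q) \<in> borel_measurable \<mu>"
      by (rule measurable_from_stiefel[OF sets]) measurable
    show "U ** X ** Q \<in> stiefel" if "X \<in> space \<mu>" for X
      using that \<open>U \<in> stiefel\<close> \<open>Q \<in> stiefel\<close> by (intro stiefel_mult) (simp_all add: space_stiefel[OF sets])
  qed
  have "distr \<mu> \<mu> (\<lambda>X. U ** X ** Q) = \<mu> \<longleftrightarrow>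
    (\<forall>F \<in> borel_measurable borel. (\<integral>\<^sup>+X. F (U ** X ** Q) \<partial>\<mu>) = (\<integral>\<^sup>+X. (F X :: ennreal) \<partial>\<mu>))"
    if "U \<in> stiefel" "Q \<in> stiefel" for U Q
  proof -
    have *: "(\<integral>\<^sup>+X. F X \<partial>distr \<mu> \<mu> (\<lambda>X. U ** X ** Q)) = (\<integral>\<^sup>+X. F (U ** X ** Q) \<partial>\<mu>)"
      if "F \<in> borel_measurable borel" for F :: "complex^'r^'m \<Rightarrow> ennreal"
      using measurable_from_stiefel[OF sets that]
      by (intro nn_integral_distr trans \<open>U \<in> stiefel\<close> \<open>Q \<in> stiefel\<close>) (simp_all cong: measurable_cong_sets)
    show ?thesis
    proof
      assume eq: "distr \<mu> \<mu> (\<lambda>X. U ** X ** Q) = \<mu>"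
      show "\<forall>F \<in> borel_measurable borel. (\<integral>\<^sup>+X. F (U ** X ** Q) \<partial>\<mu>) = (\<integral>\<^sup>+X. (F X :: ennreal) \<partial>\<mu>)"
        using *[unfolded eq] by (intro ballI) (rule sym)
    next
      assume "\<forall>F \<in> borel_measurable borel. (\<integral>\<^sup>+X. F (U ** X ** Q) \<partial>\<mu>) = (\<integral>\<^sup>+X. (F X :: ennreal) \<partial>\<mu>)"
      then show "distr \<mu> \<mu> (\<lambda>X. U ** X ** Q) = \<mu>"
        by (intro stiefel_measure_eqI) (simp_all add: * sets)
    qed
  qed
  then show ?thesis
    unfolding is_stiefel_measure_def unitary_iff_stiefel using sets by blast
qed

lemma nn_integral_stiefel_invariant:
  fixes \<mu> :: "(complex^'r^'m) measure" and F :: "complex^'r^'m \<Rightarrow> ennreal"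
  assumes "is_stiefel_measure \<mu>" "U \<in> stiefel" "Q \<in> stiefel" "F \<in> borel_measurable borel"
  shows "(\<integral>\<^sup>+X. F (U ** X ** Q) \<partial>\<mu>) = (\<integral>\<^sup>+X. F X \<partial>\<mu>)"
  using assms is_stiefel_measure_iff[of \<mu>] by (simp add: is_stiefel_measure_def)

text \<open>
  Unitary invariance is inherited from Lebesgue measure and the ball, as orientations commute with
  unitary transformations of matrices of full rank.
\<close>

lemma is_stiefel_measure_ball:
  assumes rm: "CARD('r) \<le> CARD('m)"
  shows "is_stiefel_measure
    (distr (uniform_measure lborel (cball 0 1)) (restrict_space borel stiefel) (orientation :: complex^'r^'m \<Rightarrow> _))"
    (is "is_stiefel_measure ?\<sigma>")
proof (subst is_stiefel_measure_iff)
  let ?u = "uniform_measure lborel (cball (0 :: complex^'r^'m) 1)"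
  note [measurable] = borel_measurable_orientation[OF rm]
  have orient: "orientation \<in> measurable ?u (restrict_space borel stiefel)"
    by (intro measurable_restrict_space2) (auto simp: orientation_in_stiefel[OF rm])
  show "sets ?\<sigma> = sets (restrict_space borel stiefel)"
    by simp
  have ball: "emeasure lborel (cball (0 :: complex^'r^'m) 1) \<noteq> 0" "emeasure lborel (cball (0 :: complex^'r^'m) 1) \<noteq> \<infinity>"
    using emeasure_unit_ball[where 'a="complex^'r^'m"] by simp_all
  then have "prob_space ?u"
    by (rule prob_space_uniform_measure)
  then have prob: "prob_space ?\<sigma>"
    by (rule prob_space.prob_space_distr[OF _ orient])
  have "(\<integral>\<^sup>+X. F (U ** X ** Q) \<partial>?\<sigma>) = (\<integral>\<^sup>+X. F X \<partial>?\<sigma>)"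
    if U: "U \<in> stiefel" and Q: "Q \<in> stiefel" and F [measurable]: "F \<in> borel_measurable borel"
    for U Q and F :: "complex^'r^'m \<Rightarrow> ennreal"
  proof -
    have *: "(\<integral>\<^sup>+X. G X \<partial>?\<sigma>) = (\<integral>\<^sup>+X. G (orientation X) * indicator (cball 0 1) X \<partial>lborel) / emeasure lborel (cball (0::complex^'r^'m) 1)"
      if G [measurable]: "G \<in> borel_measurable borel" for G :: "complex^'r^'m \<Rightarrow> ennreal"
    proof -
      have "(\<integral>\<^sup>+X. G X \<partial>?\<sigma>) = (\<integral>\<^sup>+X. G (orientation X) \<partial>?u)"
        by (rule nn_integral_distr[OF orient measurable_from_stiefel[OF sets_distr G]])
      also have "\<dots> = (\<integral>\<^sup>+X. G (orientation X) * indicator (cball 0 1) X \<partial>lborel) / emeasure lborel (cball (0::complex^'r^'m) 1)"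
        by (rule nn_integral_uniform_measure) simp_all
      finally show ?thesis .
    qed
    have "(\<integral>\<^sup>+X. F (U ** orientation X ** Q) * indicator (cball 0 1) X \<partial>lborel) =
        (\<integral>\<^sup>+X. F (orientation (U ** X ** Q)) * indicator (cball 0 1) (U ** X ** Q) \<partial>lborel)"
    proof (rule nn_integral_cong_AE)
      show "AE X in lborel. F (U ** orientation X ** Q) * indicator (cball 0 1) X =
          F (orientation (U ** X ** Q)) * indicator (cball 0 1) (U ** X ** Q)"
        using AE_full_rank[OF rm]
      proof eventually_elim
        case (elim X)
        then show ?case
          using U Q by (simp add: orientation_unitary_mult[OF rm] indicator_def norm_mult_unitary norm_stiefel_mult)
      qed
    qed
    also have "\<dots> = (\<integral>\<^sup>+X. F (orientation X) * indicator (cball 0 1) X \<partial>lborel)"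
      by (rule nn_integral_unitary_mult[OF U Q])
        (intro borel_measurable_times_ennreal borel_measurable_indicator_ball, measurable)
    finally show ?thesis
      by (simp add: *)
  qed
  then show "prob_space ?\<sigma> \<and> (\<forall>U \<in> stiefel. \<forall>Q \<in> stiefel. \<forall>F \<in> borel_measurable borel.
      (\<integral>\<^sup>+X. F (U ** X ** Q) \<partial>?\<sigma>) = (\<integral>\<^sup>+X. (F X :: ennreal) \<partial>?\<sigma>))"
    using prob by blast
qed

text \<open>
  Integrate \<open>F (V ** X)\<close> over both variables. By the left invariance of \<open>\<mu>\<close> the inner integral
  over \<open>X\<close> is that of \<open>F\<close>. By the right invariance of \<open>\<nu>\<close> and transitivity of the unitary group, the inner
  integral over \<open>V\<close> has the same value for all \<open>X\<close> in the Stiefel manifold. In particular \<open>\<mu>\<close> is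
  determined by \<open>\<nu>\<close>.
\<close>

lemma nn_integral_orbit_eq:
  fixes \<mu> :: "(complex^'r^'m) measure" and \<nu> :: "(complex^'m^'m) measure"
  assumes \<mu>: "is_stiefel_measure \<mu>" and \<nu>: "is_stiefel_measure \<nu>"
    and H: "H \<in> stiefel" and F: "F \<in> borel_measurable borel"
  shows "(\<integral>\<^sup>+V. F (V ** H) \<partial>\<nu>) = (\<integral>\<^sup>+X. (F X :: ennreal) \<partial>\<mu>)"
proof -
  have sets: "sets \<mu> = sets (restrict_space borel stiefel)" "sets \<nu> = sets (restrict_space borel stiefel)"
    using \<mu> \<nu> by (simp_all add: is_stiefel_measure_def)
  interpret \<mu>: prob_space \<mu>
    using \<mu> by (simp add: is_stiefel_measure_def)
  interpret \<nu>: prob_space \<nu>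
    using \<nu> by (simp add: is_stiefel_measure_def)
  interpret pair_sigma_finite \<nu> \<mu> ..
  note [measurable] = F
  have mat1: "mat 1 \<in> stiefel"
    by (simp add: stiefel_def)
  have left: "(\<integral>\<^sup>+X. F (V ** X) \<partial>\<mu>) = (\<integral>\<^sup>+X. F X \<partial>\<mu>)" if "V \<in> stiefel" for V
    using nn_integral_stiefel_invariant[OF \<mu> that mat1 F] by simp
  have right: "(\<integral>\<^sup>+V. F (V ** X) \<partial>\<nu>) = (\<integral>\<^sup>+V. F (V ** H) \<partial>\<nu>)" if X: "X \<in> stiefel" for X
  proof -
    obtain W where W: "W \<in> stiefel" "W ** H = X"
      using unitary_transitive_on_stiefel[OF H X] .
    have "(\<lambda>V. F (V ** H)) \<in> borel_measurable borel"
      by measurable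
    then have "(\<integral>\<^sup>+V. F (mat 1 ** V ** W ** H) \<partial>\<nu>) = (\<integral>\<^sup>+V. F (V ** H) \<partial>\<nu>)"
      by (rule nn_integral_stiefel_invariant[OF \<nu> mat1 W(1)])
    then show ?thesis
      by (simp add: W(2) flip: matrix_mul_assoc)
  qed
  have pair: "(\<lambda>(V, X). F (V ** X)) \<in> borel_measurable (\<nu> \<Otimes>\<^sub>M \<mu>)"
  proof -
    have [measurable]: "fst \<in> borel_measurable (\<nu> \<Otimes>\<^sub>M \<mu>)" "snd \<in> borel_measurable (\<nu> \<Otimes>\<^sub>M \<mu>)"
      by (rule measurable_compose[OF measurable_fst] measurable_compose[OF measurable_snd],
          rule measurable_from_stiefel[OF sets(2)] measurable_from_stiefel[OF sets(1)], simp)+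
    show ?thesis
      unfolding case_prod_beta by measurable
  qed
  have "(\<integral>\<^sup>+X. F X \<partial>\<mu>) = (\<integral>\<^sup>+V. (\<integral>\<^sup>+X. F X \<partial>\<mu>) \<partial>\<nu>)"
    by (simp add: \<nu>.emeasure_space_1)
  also have "\<dots> = (\<integral>\<^sup>+V. (\<integral>\<^sup>+X. F (V ** X) \<partial>\<mu>) \<partial>\<nu>)"
    by (rule nn_integral_cong) (simp add: left space_stiefel[OF sets(2)])
  also have "\<dots> = (\<integral>\<^sup>+X. (\<integral>\<^sup>+V. F (V ** X) \<partial>\<nu>) \<partial>\<mu>)"
    using Fubini'[OF pair] by simp
  also have "\<dots> = (\<integral>\<^sup>+X. (\<integral>\<^sup>+V. F (V ** H) \<partial>\<nu>) \<partial>\<mu>)"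
    by (rule nn_integral_cong) (simp add: right space_stiefel[OF sets(1)])
  finally show ?thesis
    by (simp add: \<mu>.emeasure_space_1)
qed

lemma is_stiefel_measure_stiefel_measure:
  assumes rm: "CARD('r) \<le> CARD('m)"
  shows "is_stiefel_measure (stiefel_measure :: (complex^'r^'m) measure)"
  unfolding stiefel_measure_def
proof (rule theI)
  show "is_stiefel_measure
    (distr (uniform_measure lborel (cball 0 1)) (restrict_space borel stiefel) (orientation :: complex^'r^'m \<Rightarrow> _))"
    by (rule is_stiefel_measure_ball[OF rm])
  fix \<mu> :: "(complex^'r^'m) measure"
  assume \<mu>: "is_stiefel_measure \<mu>"
  obtain H :: "complex^'r^'m" where H: "H \<in> stiefel"
    using stiefel_nonempty[OF rm] by blast
  have \<nu>: "is_stiefel_measure (distr (uniform_measure lborel (cball 0 1)) (restrict_space borel stiefel)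
      (orientation :: complex^'m^'m \<Rightarrow> _))"
    by (rule is_stiefel_measure_ball) simp
  show "\<mu> = distr (uniform_measure lborel (cball 0 1)) (restrict_space borel stiefel) orientation"
    using \<mu> nn_integral_orbit_eq[OF \<mu> \<nu> H] nn_integral_orbit_eq[OF is_stiefel_measure_ball[OF rm] \<nu> H]
    by (intro stiefel_measure_eqI) (simp_all add: is_stiefel_measure_def)
qed

section \<open>Integration in polar coordinates\<close>

text \<open>
  The left side does not change if \<open>X\<close> is replaced by \<open>V ** X\<close> with a Haar distributed unitary \<open>V\<close>.
  This replaces the orientation of \<open>X\<close> by a random element with the invariant distribution and keeps
  the positive factor.
\<close>

lemma nn_integral_polar:
  fixes g :: "complex^'r^'m \<Rightarrow> ennreal"
  assumes rm: "CARD('r) \<le> CARD('m)" and g [measurable]: "g \<in> borel_measurable borel"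
  shows "(\<integral>\<^sup>+X. g X \<partial>lborel) =
    (\<integral>\<^sup>+X. (\<integral>\<^sup>+H. g (H ** (ctranspose (orientation X) ** X)) \<partial>stiefel_measure) \<partial>(lborel :: (complex^'r^'m) measure))"
proof -
  define \<nu> :: "(complex^'m^'m) measure" where "\<nu> = stiefel_measure"
  have \<nu>: "is_stiefel_measure \<nu>"
    unfolding \<nu>_def by (rule is_stiefel_measure_stiefel_measure) simp
  then have sets: "sets \<nu> = sets (restrict_space borel stiefel)"
    by (simp add: is_stiefel_measure_def)
  interpret \<nu>: prob_space \<nu>
    using \<nu> by (simp add: is_stiefel_measure_def)
  interpret pair_sigma_finite \<nu> "lborel :: (complex^'r^'m) measure" ..
  have pair: "(\<lambda>(V, X). g (V ** X)) \<in> borel_measurable (\<nu> \<Otimes>\<^sub>M lborel)"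
  proof -
    have [measurable]: "fst \<in> borel_measurable (\<nu> \<Otimes>\<^sub>M (lborel :: (complex^'r^'m) measure))"
      by (rule measurable_compose[OF measurable_fst], rule measurable_from_stiefel[OF sets], simp)
    show ?thesis
      unfolding case_prod_beta by measurable
  qed
  have mat1: "mat 1 \<in> stiefel"
    by (simp add: stiefel_def)
  have "(\<integral>\<^sup>+X. g X \<partial>lborel) = (\<integral>\<^sup>+V. (\<integral>\<^sup>+X. g X \<partial>lborel) \<partial>\<nu>)"
    by (simp add: \<nu>.emeasure_space_1)
  also have "\<dots> = (\<integral>\<^sup>+V. (\<integral>\<^sup>+X. g (V ** X) \<partial>lborel) \<partial>\<nu>)"
    using nn_integral_unitary_mult[OF _ mat1 g]
    by (intro nn_integral_cong[of \<nu>]) (simp add: space_stiefel[OF sets])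
  also have "\<dots> = (\<integral>\<^sup>+X. (\<integral>\<^sup>+V. g (V ** X) \<partial>\<nu>) \<partial>lborel)"
    using Fubini'[OF pair] by simp
  also have "\<dots> = (\<integral>\<^sup>+X. (\<integral>\<^sup>+H. g (H ** (ctranspose (orientation X) ** X)) \<partial>stiefel_measure) \<partial>(lborel :: (complex^'r^'m) measure))"
  proof (rule nn_integral_cong_AE)
    show "AE X in lborel. (\<integral>\<^sup>+V. g (V ** X) \<partial>\<nu>) =
        (\<integral>\<^sup>+H. g (H ** (ctranspose (orientation X) ** X)) \<partial>stiefel_measure)"
      using AE_full_rank[OF rm]
    proof eventually_elim
      case (elim X)
      have "(\<integral>\<^sup>+V. g (V ** X) \<partial>\<nu>) =
          (\<integral>\<^sup>+V. g (V ** orientation X ** (ctranspose (orientation X) ** X)) \<partial>\<nu>)"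
        using orientation_polar(2)[OF rm elim] by (simp flip: matrix_mul_assoc)
      also have "\<dots> = (\<integral>\<^sup>+H. g (H ** (ctranspose (orientation X) ** X)) \<partial>stiefel_measure)"
        by (rule nn_integral_orbit_eq[OF is_stiefel_measure_stiefel_measure[OF rm] \<nu> orientation_in_stiefel[OF rm]])
          measurable
      finally show ?case .
    qed
  qed
  finally show ?thesis .
qed

section \<open>The orientation of a uniformly distributed point of an ellipsoid\<close>

lemma matrix_inv_eqI:
  fixes A :: "'a::field^'n^'n"
  assumes "A ** X = mat 1"
  shows "matrix_inv A = X"
proof -
  have "invertible A"
    using assms invertible_right_inverse by blast
  then show ?thesis
    using assms by (metis matrix_inv_inverse(2) matrix_mul_assoc matrix_mul_lid matrix_mul_rid)
qed

lemma inverse_herm_pos_def_factor: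
  fixes P :: "complex^'n^'n"
  assumes "herm_pos_def P"
  obtains L :: "complex^'n^'n" where "P ** (ctranspose L ** L) = mat 1"
proof -
  obtain R where R: "det R \<noteq> 0" "P = ctranspose R ** R"
    using herm_pos_def_factor[OF assms] .
  obtain R' where R': "R ** R' = mat 1"
    using R(1) by (metis invertible_def invertible_det_nz)
  have "P ** (R' ** ctranspose R') = ctranspose R ** (R ** R') ** ctranspose R'"
    by (simp add: R(2) matrix_mul_assoc)
  also have "\<dots> = ctranspose (R' ** R)"
    by (simp add: R' ctranspose_mult)
  also have "\<dots> = mat 1"
    using R' by (simp add: matrix_left_right_inverse[of R R'])
  finally show thesis
    using that[of "ctranspose R'"] by simp
qed

lemma det_gram: "det (ctranspose R ** R) = of_real (cmod (det R) ^ 2)"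
  by (simp add: det_mul det_ctranspose complex_norm_square mult.commute del: of_real_power)

lemma gram_square_factor:
  fixes H :: "complex^'r^'m"
  assumes "full_rank H"
  obtains R :: "complex^'r^'r" where "det R \<noteq> 0" "ctranspose H ** H = ctranspose R ** R"
proof -
  have "herm_pos_def (mat 1 :: complex^'m^'m)"
    by (simp add: herm_pos_def_inner)
  then have "herm_pos_def (ctranspose H ** H)"
    using herm_pos_def_conjugate[of "mat 1" H] assms by simp
  then show thesis
    using that herm_pos_def_factor by blast
qed

text \<open>
  The density in terms of a factor \<open>L\<close> of the inverse of \<open>P\<close>. Both determinants are real and positive
  because they are determinants of Gram matrices or their inverses.
\<close>

lemma CMACG_density_eq:
  fixes P L :: "complex^'m^'m" and H :: "complex^'r^'m"
  assumes L: "P ** (ctranspose L ** L) = mat 1" and H: "H \<in> stiefel"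
  shows "CMACG_density P H =
    cmod (det L) ^ (2 * CARD('r)) / cmod (det (ctranspose (L ** H) ** (L ** H))) ^ CARD('m)"
proof -
  have "det P * of_real (cmod (det L) ^ 2) = 1"
    using L by (metis det_I det_gram det_mul)
  then have P: "inverse (det P) = of_real (cmod (det L) ^ 2)"
    by (metis inverse_unique)
  have "det L \<noteq> 0"
    using \<open>det P * of_real (cmod (det L) ^ 2) = 1\<close> by auto
  then have "full_rank (L ** H)"
    using H by (simp add: full_rank_mult full_rank_stiefel full_rank_square_iff)
  then obtain R where R: "ctranspose (L ** H) ** (L ** H) = ctranspose R ** (R :: complex^'r^'r)"
    using gram_square_factor by blast
  have "ctranspose H ** matrix_inv P ** H = ctranspose (L ** H) ** (L ** H)"
    unfolding matrix_inv_eqI[OF L] by (simp add: ctranspose_mult matrix_mul_assoc)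
  then have "CMACG_density P H =
      Re (inverse (det P) ^ CARD('r) * inverse (of_real (cmod (det R) ^ 2)) ^ CARD('m))"
    by (simp add: CMACG_density_def R det_gram power_int_minus power_inverse)
  also have "\<dots> = Re (of_real ((cmod (det L) ^ 2) ^ CARD('r) * inverse (cmod (det R) ^ 2) ^ CARD('m)))"
    by (simp add: P)
  also have "\<dots> = cmod (det L) ^ (2 * CARD('r)) / cmod (of_real (cmod (det R) ^ 2)) ^ CARD('m)"
    by (simp only: Re_complex_of_real norm_of_real) (simp add: power_mult divide_inverse power_inverse)
  finally show ?thesis
    by (simp only: R det_gram)
qed

lemma borel_measurable_CMACG_density:
  fixes P :: "complex^'m^'m"
  assumes rm: "CARD('r) \<le> CARD('m)" and P: "herm_pos_def P"
  shows "(\<lambda>X :: complex^'r^'m. ennreal (CMACG_density P X)) \<in> borel_measurable stiefel_measure"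
proof -
  have sets: "sets (stiefel_measure :: (complex^'r^'m) measure) = sets (restrict_space borel stiefel)"
    using is_stiefel_measure_stiefel_measure[OF rm] by (simp add: is_stiefel_measure_def)
  obtain L :: "complex^'m^'m" where L: "P ** (ctranspose L ** L) = mat 1"
    using inverse_herm_pos_def_factor[OF P] .
  have "(\<lambda>X :: complex^'r^'m. ennreal (cmod (det L) ^ (2 * CARD('r)) /
      cmod (det (ctranspose (L ** X) ** (L ** X))) ^ CARD('m))) \<in> borel_measurable stiefel_measure"
    by (rule measurable_from_stiefel[OF sets]) measurable
  then show ?thesis
    by (rule measurable_cong[THEN iffD1, rotated]) (simp add: CMACG_density_eq[OF L] space_stiefel[OF sets])
qed

text \<open>
  In polar coordinates the orientation of \<open>H ** S\<close> is \<open>H\<close>, so the claim is the value of the inner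
  integral over the positive factor \<open>S\<close> for fixed \<open>H\<close>. Only \<open>ctranspose H ** matrix_inv P ** H\<close> enters
  it, and a factor \<open>R\<close> of this matrix can be moved to the right of \<open>S\<close>, where it acts on \<open>X\<close>.
\<close>

lemma nn_integral_ellipsoid_orientation:
  fixes F :: "complex^'r^'m \<Rightarrow> ennreal" and P L :: "complex^'m^'m"
  assumes rm: "CARD('r) \<le> CARD('m)" and L: "P ** (ctranspose L ** L) = mat 1"
    and F [measurable]: "F \<in> borel_measurable borel"
  shows "ennreal (cmod (det L) ^ (2 * CARD('r))) *
      (\<integral>\<^sup>+X. F (orientation X) * indicator (cball 0 1) (L ** X) \<partial>lborel) =
    emeasure lborel (cball (0 :: complex^'r^'m) 1) *
      (\<integral>\<^sup>+H. ennreal (CMACG_density P H) * F H \<partial>stiefel_measure)"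
proof -
  define \<sigma> :: "(complex^'r^'m) measure" where "\<sigma> = stiefel_measure"
  define ball :: "complex^'r^'m \<Rightarrow> ennreal" where "ball = indicator (cball 0 1)"
  define V where "V = emeasure lborel (cball (0 :: complex^'r^'m) 1)"
  have ball [measurable]: "ball \<in> borel_measurable borel"
    unfolding ball_def by (rule borel_measurable_indicator_ball)
  have ball_cong: "ball X = ball Y" if "norm X = norm Y" for X Y
    using that by (simp add: ball_def indicator_def)
  have "is_stiefel_measure \<sigma>"
    unfolding \<sigma>_def by (rule is_stiefel_measure_stiefel_measure[OF rm])
  then have sets: "sets \<sigma> = sets (restrict_space borel stiefel)" and "prob_space \<sigma>"
    by (simp_all add: is_stiefel_measure_def)
  interpret \<sigma>: prob_space \<sigma>
    by fact
  interpret pair_sigma_finite \<sigma> "lborel :: (complex^'r^'m) measure" ..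
  note [measurable] = borel_measurable_orientation[OF rm]
  define S :: "complex^'r^'m \<Rightarrow> complex^'r^'r" where "S X = ctranspose (orientation X) ** X" for X
  have S [measurable]: "S \<in> borel_measurable borel"
    unfolding S_def by measurable
  have detL: "det L \<noteq> 0"
    using L by (metis det_I det_mul mult_zero_right zero_neq_one)
  have orient: "orientation (H ** S X) = H" if "full_rank X" "H \<in> stiefel" for X H :: "complex^'r^'m"
  proof (rule orientation_eqI[OF _ that(2)])
    have "full_rank (S X)"
      using that(1) orientation_polar(2)[OF rm that(1)] unfolding S_def by (metis full_rank_mult_right)
    then show "full_rank (H ** S X)"
      using full_rank_stiefel[OF that(2)] by (rule full_rank_mult[rotated])
    show "herm_psd (S X)"
      unfolding S_def by (rule orientation_polar(1)[OF rm that(1)])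
  qed simp
  have inner: "ennreal (cmod (det L) ^ (2 * CARD('r))) * (\<integral>\<^sup>+X. ball (L ** (H ** S X)) \<partial>lborel) =
      ennreal (CMACG_density P H) * V" if H: "H \<in> stiefel" for H
  proof -
    have "full_rank (L ** H)"
      using H detL by (simp add: full_rank_mult full_rank_stiefel full_rank_square_iff)
    then obtain R :: "complex^'r^'r" where R: "det R \<noteq> 0"
      "ctranspose (L ** H) ** (L ** H) = ctranspose R ** R"
      using gram_square_factor by blast
    define q where "q = cmod (det R) ^ (2 * CARD('m))"
    have q: "0 < q"
      using R by (simp add: q_def)
    have "(\<integral>\<^sup>+X. ball (L ** (H ** S X)) \<partial>lborel) = (\<integral>\<^sup>+X. ball (X ** ctranspose R) \<partial>lborel)"
    proof (rule nn_integral_cong_AE)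
      show "AE X in lborel. ball (L ** (H ** S X)) = ball (X ** ctranspose R)"
        using AE_full_rank[OF rm]
      proof eventually_elim
        case (elim X)
        have SX: "ctranspose (S X) = S X"
          using orientation_polar(1)[OF rm elim] by (simp add: S_def herm_psd_def)
        have "norm (L ** (H ** S X)) = norm (R ** S X)"
        proof -
          have "(L ** H ** S X) \<bullet> (L ** H ** S X) = S X \<bullet> ((ctranspose (L ** H) ** (L ** H)) ** S X)"
            by (simp add: inner_matrix_mult_left matrix_mul_assoc)
          also have "\<dots> = (R ** S X) \<bullet> (R ** S X)"
            unfolding R(2) by (simp add: inner_matrix_mult_left matrix_mul_assoc)
          finally show ?thesis
            by (simp add: norm_eq_sqrt_inner matrix_mul_assoc)
        qed
        also have "\<dots> = norm (S X ** ctranspose R)"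
          using norm_ctranspose[of "R ** S X"] by (simp add: ctranspose_mult SX)
        also have "\<dots> = norm (orientation X ** (S X ** ctranspose R))"
          by (rule norm_stiefel_mult[OF orientation_in_stiefel[OF rm], symmetric])
        also have "orientation X ** (S X ** ctranspose R) = X ** ctranspose R"
          using orientation_polar(2)[OF rm elim] unfolding S_def by (metis matrix_mul_assoc)
        finally show ?case
          by (rule ball_cong)
      qed
    qed
    also have "\<dots> = ennreal (inverse q) * V"
    proof -
      have "det (ctranspose R) \<noteq> 0"
        using R by (simp add: det_ctranspose)
      then have "V = ennreal q * (\<integral>\<^sup>+X. ball (X ** ctranspose R) \<partial>lborel)"
        using nn_integral_matrix_mult_right[OF _ ball, of "ctranspose R"]
        by (simp add: q_def V_def ball_def det_ctranspose)
      then have "ennreal (inverse q) * V = (ennreal (inverse q) * ennreal q) * (\<integral>\<^sup>+X. ball (X ** ctranspose R) \<partial>lborel)"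
        by (simp add: mult.assoc)
      also have "ennreal (inverse q) * ennreal q = 1"
        using q by (simp flip: ennreal_mult)
      finally show ?thesis
        by simp
    qed
    finally have "ennreal (cmod (det L) ^ (2 * CARD('r))) * (\<integral>\<^sup>+X. ball (L ** (H ** S X)) \<partial>lborel) =
        ennreal (cmod (det L) ^ (2 * CARD('r)) * inverse q) * V"
      using q by (simp add: ennreal_mult mult.assoc)
    also have "cmod (det L) ^ (2 * CARD('r)) * inverse q = CMACG_density P H"
      unfolding CMACG_density_eq[OF L H] R(2) det_gram
      by (simp add: q_def power_mult divide_inverse norm_power)
    finally show ?thesis .
  qed
  have "(\<integral>\<^sup>+X. F (orientation X) * ball (L ** X) \<partial>lborel) =
      (\<integral>\<^sup>+X. (\<integral>\<^sup>+H. F (orientation (H ** S X)) * ball (L ** (H ** S X)) \<partial>\<sigma>) \<partial>lborel)"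
    unfolding S_def \<sigma>_def by (rule nn_integral_polar[OF rm]) measurable
  also have "\<dots> = (\<integral>\<^sup>+X. (\<integral>\<^sup>+H. F H * ball (L ** (H ** S X)) \<partial>\<sigma>) \<partial>lborel)"
  proof (rule nn_integral_cong_AE)
    show "AE X in lborel. (\<integral>\<^sup>+H. F (orientation (H ** S X)) * ball (L ** (H ** S X)) \<partial>\<sigma>) =
        (\<integral>\<^sup>+H. F H * ball (L ** (H ** S X)) \<partial>\<sigma>)"
      using AE_full_rank[OF rm]
      by eventually_elim (auto intro!: nn_integral_cong simp: orient space_stiefel[OF sets])
  qed
  also have "\<dots> = (\<integral>\<^sup>+H. (\<integral>\<^sup>+X. F H * ball (L ** (H ** S X)) \<partial>lborel) \<partial>\<sigma>)"
  proof -
    have [measurable]: "fst \<in> borel_measurable (\<sigma> \<Otimes>\<^sub>M (lborel :: (complex^'r^'m) measure))"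
      by (rule measurable_compose[OF measurable_fst], rule measurable_from_stiefel[OF sets], simp)
    have "(\<lambda>(H, X). F H * ball (L ** (H ** S X))) \<in> borel_measurable (\<sigma> \<Otimes>\<^sub>M lborel)"
      unfolding case_prod_beta by measurable
    from Fubini'[OF this] show ?thesis
      by simp
  qed
  also have "\<dots> = (\<integral>\<^sup>+H. F H * (\<integral>\<^sup>+X. ball (L ** (H ** S X)) \<partial>lborel) \<partial>\<sigma>)"
    by (intro nn_integral_cong[of \<sigma>] nn_integral_cmult) measurable
  finally have "ennreal (cmod (det L) ^ (2 * CARD('r))) * (\<integral>\<^sup>+X. F (orientation X) * ball (L ** X) \<partial>lborel) =
      ennreal (cmod (det L) ^ (2 * CARD('r))) * (\<integral>\<^sup>+H. F H * (\<integral>\<^sup>+X. ball (L ** (H ** S X)) \<partial>lborel) \<partial>\<sigma>)"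
    by simp
  also have "\<dots> = (\<integral>\<^sup>+H. ennreal (cmod (det L) ^ (2 * CARD('r))) * (F H * (\<integral>\<^sup>+X. ball (L ** (H ** S X)) \<partial>lborel)) \<partial>\<sigma>)"
    by (intro nn_integral_cmult[symmetric] measurable_from_stiefel[OF sets]) measurable
  also have "\<dots> = (\<integral>\<^sup>+H. V * (ennreal (CMACG_density P H) * F H) \<partial>\<sigma>)"
  proof (rule nn_integral_cong)
    fix H assume "H \<in> space \<sigma>"
    then have H: "H \<in> stiefel"
      by (simp add: space_stiefel[OF sets])
    show "ennreal (cmod (det L) ^ (2 * CARD('r))) * (F H * (\<integral>\<^sup>+X. ball (L ** (H ** S X)) \<partial>lborel)) =
        V * (ennreal (CMACG_density P H) * F H)"
      by (subst mult.left_commute, subst inner[OF H]) (simp add: mult_ac)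
  qed
  also have "\<dots> = V * (\<integral>\<^sup>+H. ennreal (CMACG_density P H) * F H \<partial>\<sigma>)"
  proof (rule nn_integral_cmult)
    have "(\<lambda>H :: complex^'r^'m. ennreal (cmod (det L) ^ (2 * CARD('r)) /
        cmod (det (ctranspose (L ** H) ** (L ** H))) ^ CARD('m)) * F H) \<in> borel_measurable \<sigma>"
      by (rule measurable_from_stiefel[OF sets]) measurable
    then show "(\<lambda>H. ennreal (CMACG_density P H) * F H) \<in> borel_measurable \<sigma>"
      by (rule measurable_cong[THEN iffD1, rotated]) (simp add: CMACG_density_eq[OF L] space_stiefel[OF sets])
  qed
  finally show ?thesis
    by (simp add: V_def ball_def \<sigma>_def)
qed

section \<open>Left multiplication acts on laws of orientations\<close>

text \<open>
  The function \<open>G\<close> does not depend on \<open>w\<close>. Since \<open>w\<close> is right invariant, \<open>X\<close> may be replaced by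
  \<open>X ** Q\<close> for a Haar distributed unitary \<open>Q\<close>; the mean over \<open>Q\<close> absorbs the unitary factor by which
  the orientations of \<open>B ** X\<close> and \<open>B ** orientation X\<close> differ.
\<close>

lemma nn_integral_orientation_left_mult:
  fixes F :: "complex^'r^'m \<Rightarrow> ennreal" and B :: "complex^'m^'m"
  assumes rm: "CARD('r) \<le> CARD('m)" and B: "det B \<noteq> 0" and F [measurable]: "F \<in> borel_measurable borel"
  obtains G :: "complex^'r^'m \<Rightarrow> ennreal" where "G \<in> borel_measurable borel"
    and "\<And>w :: complex^'r^'m \<Rightarrow> ennreal. w \<in> borel_measurable borel \<Longrightarrow>
      (\<And>X Q. Q \<in> stiefel \<Longrightarrow> w (X ** Q) = w X) \<Longrightarrow>
      (\<integral>\<^sup>+X. w X * F (orientation (B ** X)) \<partial>lborel) = (\<integral>\<^sup>+X. w X * G (orientation X) \<partial>lborel)"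
proof -
  define \<rho> :: "(complex^'r^'r) measure" where "\<rho> = stiefel_measure"
  have \<rho>: "is_stiefel_measure \<rho>"
    unfolding \<rho>_def by (rule is_stiefel_measure_stiefel_measure) simp
  then have sets: "sets \<rho> = sets (restrict_space borel stiefel)" and "prob_space \<rho>"
    by (simp_all add: is_stiefel_measure_def)
  interpret \<rho>: prob_space \<rho>
    by fact
  interpret pair_sigma_finite \<rho> "lborel :: (complex^'r^'m) measure" ..
  note [measurable] = borel_measurable_orientation[OF rm]
  have mat1: "mat 1 \<in> stiefel"
    by (simp add: stiefel_def)
  have fullB: "full_rank B"
    using B by (simp add: full_rank_square_iff)
  define G where "G H = (\<integral>\<^sup>+Q. F (orientation (B ** H) ** Q) \<partial>\<rho>)" for H
  show thesis
  proof
    show "G \<in> borel_measurable borel"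
    proof -
      have [measurable]: "snd \<in> borel_measurable ((borel :: (complex^'r^'m) measure) \<Otimes>\<^sub>M \<rho>)"
        by (rule measurable_compose[OF measurable_snd], rule measurable_from_stiefel[OF sets], simp)
      have "(\<lambda>(H, Q). F (orientation (B ** H) ** Q)) \<in> borel_measurable (borel \<Otimes>\<^sub>M \<rho>)"
        unfolding case_prod_beta by measurable
      then show ?thesis
        unfolding G_def
        by (rule \<rho>.borel_measurable_nn_integral)
    qed
  next
    fix w :: "complex^'r^'m \<Rightarrow> ennreal"
    assume w [measurable]: "w \<in> borel_measurable borel"
      and inv: "\<And>X Q. Q \<in> stiefel \<Longrightarrow> w (X ** Q) = w X"
    have rotate: "(\<integral>\<^sup>+X. w X * F (orientation (B ** X)) \<partial>lborel) =
        (\<integral>\<^sup>+X. w X * F (orientation (B ** X) ** Q) \<partial>lborel)" if Q: "Q \<in> stiefel" for Q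
    proof -
      have "(\<integral>\<^sup>+X. w X * F (orientation (B ** X)) \<partial>lborel) =
          (\<integral>\<^sup>+X. w (mat 1 ** X ** Q) * F (orientation (B ** (mat 1 ** X ** Q))) \<partial>lborel)"
        by (rule nn_integral_unitary_mult[OF mat1 Q, symmetric]) measurable
      also have "\<dots> = (\<integral>\<^sup>+X. w X * F (orientation (B ** X) ** Q) \<partial>lborel)"
      proof (rule nn_integral_cong_AE)
        show "AE X in lborel. w (mat 1 ** X ** Q) * F (orientation (B ** (mat 1 ** X ** Q))) =
            w X * F (orientation (B ** X) ** Q)"
          using AE_full_rank[OF rm]
        proof eventually_elim
          case (elim X)
          have "orientation (mat 1 ** (B ** X) ** Q) = mat 1 ** orientation (B ** X) ** Q"
            by (rule orientation_unitary_mult[OF rm full_rank_mult[OF fullB elim] mat1 Q])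
          then show ?case
            using inv[OF Q] by (simp add: matrix_mul_assoc)
        qed
      qed
      finally show ?thesis .
    qed
    have "(\<integral>\<^sup>+X. w X * F (orientation (B ** X)) \<partial>lborel) =
        (\<integral>\<^sup>+Q. (\<integral>\<^sup>+X. w X * F (orientation (B ** X)) \<partial>lborel) \<partial>\<rho>)"
      by (simp add: \<rho>.emeasure_space_1)
    also have "\<dots> = (\<integral>\<^sup>+Q. (\<integral>\<^sup>+X. w X * F (orientation (B ** X) ** Q) \<partial>lborel) \<partial>\<rho>)"
      by (rule nn_integral_cong) (simp add: space_stiefel[OF sets] rotate)
    also have "\<dots> = (\<integral>\<^sup>+X. (\<integral>\<^sup>+Q. w X * F (orientation (B ** X) ** Q) \<partial>\<rho>) \<partial>lborel)"
    proof -
      have [measurable]: "fst \<in> borel_measurable (\<rho> \<Otimes>\<^sub>M (lborel :: (complex^'r^'m) measure))"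
        by (rule measurable_compose[OF measurable_fst], rule measurable_from_stiefel[OF sets], simp)
      have "(\<lambda>(Q, X). w X * F (orientation (B ** X) ** Q)) \<in> borel_measurable (\<rho> \<Otimes>\<^sub>M lborel)"
        unfolding case_prod_beta by measurable
      from Fubini'[OF this] show ?thesis
        by simp
    qed
    also have "\<dots> = (\<integral>\<^sup>+X. w X * G (orientation X) \<partial>lborel)"
    proof (rule nn_integral_cong_AE)
      show "AE X in lborel. (\<integral>\<^sup>+Q. w X * F (orientation (B ** X) ** Q) \<partial>\<rho>) = w X * G (orientation X)"
        using AE_full_rank[OF rm]
      proof eventually_elim
        case (elim X)
        have meas: "(\<lambda>Q. F (H ** Q)) \<in> borel_measurable borel" for H :: "complex^'r^'m"
          by measurable
        obtain Q' where Q': "Q' \<in> stiefel" "orientation (B ** X) = orientation (B ** orientation X) ** Q'"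
          using orientation_left_mult[OF rm elim fullB] .
        have "(\<integral>\<^sup>+Q. F (orientation (B ** X) ** Q) \<partial>\<rho>) =
            (\<integral>\<^sup>+Q. F (orientation (B ** orientation X) ** (Q' ** Q ** mat 1)) \<partial>\<rho>)"
          by (simp add: Q'(2) matrix_mul_assoc)
        also have "\<dots> = G (orientation X)"
          unfolding G_def by (rule nn_integral_stiefel_invariant[OF \<rho> Q'(1) mat1 meas])
        finally show ?case
          by (subst nn_integral_cmult) (simp_all add: measurable_from_stiefel[OF sets meas])
      qed
    qed
    finally show "(\<integral>\<^sup>+X. w X * F (orientation (B ** X)) \<partial>lborel) = (\<integral>\<^sup>+X. w X * G (orientation X) \<partial>lborel)" .
  qed
qed

section \<open>Left multiplication of a random matrix\<close>

theorem corollary1: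
  fixes P B :: "complex^'m^'m"
    and M :: "'a measure"
    and Z :: "'a \<Rightarrow> complex^'r^'m"
    and f\<^sub>Z :: "complex^'r^'m \<Rightarrow> real"
  assumes "CARD('r) \<le> CARD('m)"
    and "herm_pos_def P"
    and "det B \<noteq> 0"
    and "prob_space M"
    and "\<And>X. 0 \<le> f\<^sub>Z X"
    and "distributed M lborel Z (\<lambda>X. ennreal (f\<^sub>Z X))"
    and "\<And>X Q. ctranspose Q ** Q = mat 1 \<Longrightarrow> f\<^sub>Z (X ** Q) = f\<^sub>Z X"
    and "CMACG M P (\<lambda>\<omega>. orientation (Z \<omega>))"
  shows "CMACG M (B ** P ** ctranspose B) (\<lambda>\<omega>. orientation (B ** Z \<omega>))"
proof -
  note rm = assms(1) and Z = assms(6)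
  define \<sigma> :: "(complex^'r^'m) measure" where "\<sigma> = stiefel_measure"
  have sets: "sets \<sigma> = sets (restrict_space borel stiefel)"
    using is_stiefel_measure_stiefel_measure[OF rm] by (simp add: \<sigma>_def is_stiefel_measure_def)
  note [measurable] = borel_measurable_orientation[OF rm]
  define P' where "P' = B ** P ** ctranspose B"
  have "full_rank (ctranspose B)"
    using assms(3) by (simp add: full_rank_square_iff det_ctranspose)
  then have P': "herm_pos_def P'"
    using herm_pos_def_conjugate[OF assms(2), of "ctranspose B"] by (simp add: P'_def)
  obtain L :: "complex^'m^'m" where L: "P ** (ctranspose L ** L) = mat 1"
    using inverse_herm_pos_def_factor[OF assms(2)] .
  obtain B' where B': "B ** B' = mat 1" "B' ** B = mat 1"
    using assms(3) by (metis invertible_def invertible_det_nz)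
  define L' where "L' = L ** B'"
  have L': "P' ** (ctranspose L' ** L') = mat 1"
  proof -
    have "ctranspose B ** ctranspose B' = mat 1"
      by (metis B'(2) ctranspose_mat_1 ctranspose_mult)
    moreover have "P' ** (ctranspose L' ** L') =
        B ** (P ** ((ctranspose B ** ctranspose B') ** (ctranspose L ** L))) ** B'"
      by (simp add: P'_def L'_def ctranspose_mult matrix_mul_assoc)
    ultimately show ?thesis
      by (simp add: L B')
  qed
  define V where "V = measure lborel (cball (0 :: complex^'r^'m) 1)"
  have V: "0 < V" "emeasure lborel (cball (0 :: complex^'r^'m) 1) = ennreal V"
    using emeasure_unit_ball[where 'a="complex^'r^'m"] by (simp_all add: V_def)
  define ball :: "complex^'r^'m \<Rightarrow> ennreal" where "ball = indicator (cball 0 1)"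
  have ball [measurable]: "ball \<in> borel_measurable borel"
    unfolding ball_def by (rule borel_measurable_indicator_ball)
  \<comment> \<open>the density of the uniform distribution on the ellipsoid \<open>norm (A ** X) \<le> 1\<close>\<close>
  define w where "w A X = ennreal (cmod (det A) ^ (2 * CARD('r)) / V) * ball (A ** X)"
    for A :: "complex^'m^'m" and X
  have w [measurable]: "w A \<in> borel_measurable borel" for A
    unfolding w_def by measurable
  have ellipsoid: "(\<integral>\<^sup>+X. w A X * F (orientation X) \<partial>lborel) =
      (\<integral>\<^sup>+H. ennreal (CMACG_density R H) * F H \<partial>\<sigma>)"
    if A: "R ** (ctranspose A ** A) = mat 1" and F [measurable]: "F \<in> borel_measurable borel"
    for R A :: "complex^'m^'m" and F :: "complex^'r^'m \<Rightarrow> ennreal"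
  proof -
    have "(\<integral>\<^sup>+X. w A X * F (orientation X) \<partial>lborel) =
        (\<integral>\<^sup>+X. ennreal (cmod (det A) ^ (2 * CARD('r)) / V) * (F (orientation X) * ball (A ** X)) \<partial>lborel)"
      by (simp add: w_def mult_ac)
    also have "\<dots> = ennreal (cmod (det A) ^ (2 * CARD('r)) / V) * (\<integral>\<^sup>+X. F (orientation X) * ball (A ** X) \<partial>lborel)"
      by (rule nn_integral_cmult) measurable
    also have "\<dots> = ennreal (inverse V) * (ennreal (cmod (det A) ^ (2 * CARD('r))) *
        (\<integral>\<^sup>+X. F (orientation X) * ball (A ** X) \<partial>lborel))"
      using V(1) by (simp add: divide_inverse ennreal_mult mult_ac)
    also have "\<dots> = (ennreal (inverse V) * ennreal V) * (\<integral>\<^sup>+H. ennreal (CMACG_density R H) * F H \<partial>\<sigma>)"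
      unfolding ball_def nn_integral_ellipsoid_orientation[OF rm A F] V(2) \<sigma>_def by (simp add: mult.assoc)
    also have "ennreal (inverse V) * ennreal V = 1"
      using V(1) by (simp flip: ennreal_mult)
    finally show ?thesis
      by simp
  qed
  have orient_Z: "distributed M \<sigma> (\<lambda>\<omega>. orientation (Z \<omega>)) (\<lambda>X. ennreal (CMACG_density P X))"
    using assms(8) by (simp add: CMACG_def \<sigma>_def)
  have Z_meas [measurable]: "Z \<in> borel_measurable M"
    using distributed_measurable[OF Z] by simp
  have f_meas [measurable]: "(\<lambda>X. ennreal (f\<^sub>Z X)) \<in> borel_measurable borel"
    using distributed_borel_measurable[OF Z] by simp
  have integral: "(\<integral>\<^sup>+\<omega>. F (orientation (B ** Z \<omega>)) \<partial>M) = (\<integral>\<^sup>+H. ennreal (CMACG_density P' H) * F H \<partial>\<sigma>)"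
    if F [measurable]: "F \<in> borel_measurable borel" for F
  proof -
    obtain G :: "complex^'r^'m \<Rightarrow> ennreal" where G [measurable]: "G \<in> borel_measurable borel"
      and left_mult: "\<And>w :: complex^'r^'m \<Rightarrow> ennreal. w \<in> borel_measurable borel \<Longrightarrow>
        (\<And>X Q. Q \<in> stiefel \<Longrightarrow> w (X ** Q) = w X) \<Longrightarrow>
        (\<integral>\<^sup>+X. w X * F (orientation (B ** X)) \<partial>lborel) = (\<integral>\<^sup>+X. w X * G (orientation X) \<partial>lborel)"
      using nn_integral_orientation_left_mult[OF rm assms(3) F] by blast
    have "(\<integral>\<^sup>+\<omega>. F (orientation (B ** Z \<omega>)) \<partial>M) = (\<integral>\<^sup>+X. ennreal (f\<^sub>Z X) * F (orientation (B ** X)) \<partial>lborel)"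
      by (rule distributed_nn_integral[OF Z, symmetric]) measurable
    also have "\<dots> = (\<integral>\<^sup>+X. ennreal (f\<^sub>Z X) * G (orientation X) \<partial>lborel)"
      by (rule left_mult) (simp_all add: assms(7) stiefel_def)
    also have "\<dots> = (\<integral>\<^sup>+\<omega>. G (orientation (Z \<omega>)) \<partial>M)"
      by (rule distributed_nn_integral[OF Z]) measurable
    also have "\<dots> = (\<integral>\<^sup>+H. ennreal (CMACG_density P H) * G H \<partial>\<sigma>)"
      by (rule distributed_nn_integral[OF orient_Z measurable_from_stiefel[OF sets G], symmetric])
    also have "\<dots> = (\<integral>\<^sup>+X. w L X * G (orientation X) \<partial>lborel)"
      by (rule ellipsoid[OF L G, symmetric])
    also have "\<dots> = (\<integral>\<^sup>+X. w L X * F (orientation (B ** X)) \<partial>lborel)"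
    proof (rule left_mult[symmetric])
      show "w L (X ** Q) = w L X" if "Q \<in> stiefel" for X Q
        using that by (simp add: w_def ball_def indicator_def matrix_mul_assoc norm_mult_unitary)
    qed measurable
    also have "\<dots> = (\<integral>\<^sup>+X. w L' X * F (orientation X) \<partial>lborel)"
    proof -
      have "det L = det L' * det B"
        by (metis B'(2) L'_def det_mul matrix_mul_assoc matrix_mul_rid)
      then have "w L X = ennreal (cmod (det B) ^ (2 * CARD('r))) * w L' (B ** X)" for X
        using V(1) B'(2)
        by (simp add: w_def L'_def norm_mult power_mult_distrib divide_inverse ennreal_mult mult_ac
            flip: matrix_mul_assoc) (simp add: matrix_mul_assoc B'(2))
      then have "(\<integral>\<^sup>+X. w L X * F (orientation (B ** X)) \<partial>lborel) =
          (\<integral>\<^sup>+X. ennreal (cmod (det B) ^ (2 * CARD('r))) * (w L' (B ** X) * F (orientation (B ** X))) \<partial>lborel)"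
        by (simp add: mult.assoc)
      also have "\<dots> = ennreal (cmod (det B) ^ (2 * CARD('r))) *
          (\<integral>\<^sup>+X. w L' (B ** X) * F (orientation (B ** X)) \<partial>lborel)"
        by (rule nn_integral_cmult) measurable
      also have "\<dots> = (\<integral>\<^sup>+X. w L' X * F (orientation X) \<partial>lborel)"
        by (rule nn_integral_matrix_mult_left[OF assms(3), symmetric]) measurable
      finally show ?thesis .
    qed
    also have "\<dots> = (\<integral>\<^sup>+H. ennreal (CMACG_density P' H) * F H \<partial>\<sigma>)"
      by (rule ellipsoid[OF L' F])
    finally show ?thesis .
  qed
  have Y: "(\<lambda>\<omega>. orientation (B ** Z \<omega>)) \<in> measurable M \<sigma>"
    by (rule measurable_into_stiefel[OF sets]) (simp_all add: orientation_in_stiefel[OF rm])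
  have density: "(\<lambda>X. ennreal (CMACG_density P' X)) \<in> borel_measurable \<sigma>"
    unfolding \<sigma>_def by (rule borel_measurable_CMACG_density[OF rm P'])
  have "distr M \<sigma> (\<lambda>\<omega>. orientation (B ** Z \<omega>)) = density \<sigma> (\<lambda>X. ennreal (CMACG_density P' X))"
  proof (rule stiefel_measure_eqI)
    fix F :: "complex^'r^'m \<Rightarrow> ennreal"
    assume F: "F \<in> borel_measurable borel"
    have "(\<integral>\<^sup>+X. F X \<partial>distr M \<sigma> (\<lambda>\<omega>. orientation (B ** Z \<omega>))) = (\<integral>\<^sup>+\<omega>. F (orientation (B ** Z \<omega>)) \<partial>M)"
      using measurable_from_stiefel[OF sets F] by (intro nn_integral_distr[OF Y]) simp
    also have "\<dots> = (\<integral>\<^sup>+X. F X \<partial>density \<sigma> (\<lambda>X. ennreal (CMACG_density P' X)))"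
      unfolding integral[OF F] by (rule nn_integral_density[OF density measurable_from_stiefel[OF sets F], symmetric])
    finally show "(\<integral>\<^sup>+X. F X \<partial>distr M \<sigma> (\<lambda>\<omega>. orientation (B ** Z \<omega>))) =
        (\<integral>\<^sup>+X. F X \<partial>density \<sigma> (\<lambda>X. ennreal (CMACG_density P' X)))" .
  qed (simp_all add: sets)
  then have "distributed M \<sigma> (\<lambda>\<omega>. orientation (B ** Z \<omega>)) (\<lambda>X. ennreal (CMACG_density P' X))"
    unfolding distributed_def using Y density by blast
  then show ?thesis
    using P' by (simp add: CMACG_def P'_def \<sigma>_def)
qed

end
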